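(* Let $R \subset \mathbb{Q}$ be a finite set with $|R| \ge 2$. Then $\beta_h(R) = \beta(R)$.
   Context: All random variables are discrete and finitely supported; $H$ denotes Shannon entropy and $H(X\mid Y)$ conditional entropy. For a finite set $R \subset \mathbb{Q}$, $\beta(R)$ is the smallest real number $\beta$ such that $$H(Y) \le \beta \max_{r\in R} H(X + rY)$$ holds for all integer-valued random variables $X, Y$ (defined on a common probability space). Similarly, $\beta_h(R)$ is the smallest real number $\beta_h$ such that $$H(Y) + (\beta_h - 1) H(X\mid Y) \le \beta_h \max_{r\in R} H(X + rY)$$ holds for all integer-valued random variables $X, Y$. *)

theory Defs
  imports "HOL-Probability.Information"
begin

text \<open>
  Finitely supported discrete random variables on a probability space are rendered as
  \<^const>\<open>simple_function\<close>s. Entropies are those of \<^theory>\<open>HOL-Probability.Information\<close>, in bits;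
  the base is immaterial below because all inequalities are homogeneous in the entropies.
\<close>

definition shannon_entropy :: "'a measure \<Rightarrow> ('a \<Rightarrow> 'b) \<Rightarrow> real" where
  "shannon_entropy M X = prob_space.entropy M 2 (count_space (X ` space M)) X"

definition cond_entropy :: "'a measure \<Rightarrow> ('a \<Rightarrow> 'b) \<Rightarrow> ('a \<Rightarrow> 'c) \<Rightarrow> real" where
  "cond_entropy M X Y =
     prob_space.conditional_entropy M 2 (count_space (X ` space M)) (count_space (Y ` space M)) X Y"

definition lin_comb :: "('a \<Rightarrow> int) \<Rightarrow> rat \<Rightarrow> ('a \<Rightarrow> int) \<Rightarrow> 'a \<Rightarrow> rat" where
  "lin_comb X r Y = (\<lambda>\<omega>. of_int (X \<omega>) + r * of_int (Y \<omega>))"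

definition max_entropy :: "rat set \<Rightarrow> 'a measure \<Rightarrow> ('a \<Rightarrow> int) \<Rightarrow> ('a \<Rightarrow> int) \<Rightarrow> real" where
  "max_entropy R M X Y = (MAX r\<in>R. shannon_entropy M (lin_comb X r Y))"

definition rv_pair :: "'a measure \<Rightarrow> ('a \<Rightarrow> int) \<Rightarrow> ('a \<Rightarrow> int) \<Rightarrow> bool" where
  "rv_pair M X Y \<longleftrightarrow> prob_space M \<and> simple_function M X \<and> simple_function M Y"

text \<open>
  A quantifier inside a definition cannot range over sample spaces of all types. The sample space
  type \<^typ>\<open>nat\<close> suffices, as every joint law of two such variables is realised on it;
  \<open>beta_admissible_D\<close> and \<open>beta_h_admissible_D\<close> below give the inequalities on arbitrary sample spaces.
\<close>

definition beta_admissible :: "rat set \<Rightarrow> real \<Rightarrow> bool" where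
  "beta_admissible R \<beta> \<longleftrightarrow>
     (\<forall>(M :: nat measure) X Y. rv_pair M X Y \<longrightarrow>
        shannon_entropy M Y \<le> \<beta> * max_entropy R M X Y)"

definition beta_h_admissible :: "rat set \<Rightarrow> real \<Rightarrow> bool" where
  "beta_h_admissible R \<beta> \<longleftrightarrow>
     (\<forall>(M :: nat measure) X Y. rv_pair M X Y \<longrightarrow>
        shannon_entropy M Y + (\<beta> - 1) * cond_entropy M X Y \<le> \<beta> * max_entropy R M X Y)"

text \<open>
  For \<open>2 \<le> card R\<close> the least elements exist, see \<open>beta_least\<close> and \<open>beta_h_least\<close> below.
\<close>

definition beta :: "rat set \<Rightarrow> real" where
  "beta R = (LEAST \<beta>. beta_admissible R \<beta>)"

definition beta_h :: "rat set \<Rightarrow> real" where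
  "beta_h R = (LEAST \<beta>. beta_h_admissible R \<beta>)"


subsection \<open>Independence of the sample space\<close>

lemma entropy_distr_comp:
  fixes f :: "'a \<Rightarrow> 'c" and g :: "'c \<Rightarrow> 'b" and h :: "'c \<Rightarrow> 'd"
  assumes "prob_space M" "simple_function M f"
  defines "N \<equiv> distr M (count_space (f ` space M)) f"
  shows "prob_space N" "simple_function N g"
    "shannon_entropy N g = shannon_entropy M (\<lambda>\<omega>. g (f \<omega>))"
    "cond_entropy N g h = cond_entropy M (\<lambda>\<omega>. g (f \<omega>)) (\<lambda>\<omega>. h (f \<omega>))"
proof -
  interpret M: prob_space M by fact
  have f: "f \<in> measurable M (count_space (f ` space M))"
    using assms(2) by (simp add: simple_function_def measurable_count_space_eq2)
  show N: "prob_space N"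
    unfolding N_def by (rule M.prob_space_distr[OF f])
  interpret N: prob_space N by fact
  have sp: "space N = f ` space M" by (simp add: N_def)
  have fin: "finite (f ` space M)" using assms(2) by (rule simple_functionD)
  show "simple_function N g"
    unfolding simple_function_def using fin by (auto simp: N_def)
  have d: "distr N S u = distr M S (\<lambda>\<omega>. u (f \<omega>))"
    if "u \<in> f ` space M \<rightarrow> space S" for S :: "'z measure" and u
    using distr_distr[OF _ f, of u S] that by (simp add: N_def comp_def)
  have im: "u ` space N = (\<lambda>\<omega>. u (f \<omega>)) ` space M" for u :: "'c \<Rightarrow> 'z"
    by (auto simp: sp)
  show "shannon_entropy N g = shannon_entropy M (\<lambda>\<omega>. g (f \<omega>))"
    unfolding shannon_entropy_def N.entropy_def M.entropy_def im
    by (subst d) auto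
  show "cond_entropy N g h = cond_entropy M (\<lambda>\<omega>. g (f \<omega>)) (\<lambda>\<omega>. h (f \<omega>))"
    unfolding cond_entropy_def N.conditional_entropy_def M.conditional_entropy_def im
    by (subst d, force simp: space_pair_measure)+ (rule refl)
qed

lemma rv_pair_transfer:
  fixes M :: "'a measure"
  assumes "rv_pair M X Y"
  obtains N :: "nat measure" and X' Y' where
    "rv_pair N X' Y'"
    "shannon_entropy N Y' = shannon_entropy M Y"
    "cond_entropy N X' Y' = cond_entropy M X Y"
    "\<And>R. max_entropy R N X' Y' = max_entropy R M X Y"
proof -
  have M: "prob_space M" and X: "simple_function M X" and Y: "simple_function M Y"
    using assms by (auto simp: rv_pair_def)
  define f where "f = (\<lambda>\<omega>. to_nat (X \<omega>, Y \<omega>))"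
  have f: "simple_function M f"
    unfolding f_def using simple_function_compose[OF simple_function_Pair[OF X Y], of to_nat]
    by (simp add: comp_def)
  define X' where "X' n = fst (from_nat n :: int \<times> int)" for n :: nat
  define Y' where "Y' n = snd (from_nat n :: int \<times> int)" for n :: nat
  have [simp]: "X' (f \<omega>) = X \<omega>" "Y' (f \<omega>) = Y \<omega>" for \<omega>
    by (simp_all add: X'_def Y'_def f_def)
  note * = entropy_distr_comp[OF M f]
  show thesis
  proof (rule that)
    show "rv_pair (distr M (count_space (f ` space M)) f) X' Y'"
      by (simp add: * rv_pair_def)
  qed (simp_all add: * max_entropy_def lin_comb_def)
qed

lemma beta_admissible_D:
  fixes M :: "'a measure"
  assumes "beta_admissible R \<beta>" "rv_pair M X Y"
  shows "shannon_entropy M Y \<le> \<beta> * max_entropy R M X Y"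
proof (rule rv_pair_transfer[OF assms(2)])
  fix N :: "nat measure" and X' Y'
  assume N: "rv_pair N X' Y'" "shannon_entropy N Y' = shannon_entropy M Y"
    "\<And>R. max_entropy R N X' Y' = max_entropy R M X Y"
  show ?thesis
    using assms(1) N(1) unfolding beta_admissible_def by (auto simp flip: N(2,3))
qed

lemma beta_h_admissible_D:
  fixes M :: "'a measure"
  assumes "beta_h_admissible R \<beta>" "rv_pair M X Y"
  shows "shannon_entropy M Y + (\<beta> - 1) * cond_entropy M X Y \<le> \<beta> * max_entropy R M X Y"
proof (rule rv_pair_transfer[OF assms(2)])
  fix N :: "nat measure" and X' Y'
  assume N: "rv_pair N X' Y'" "shannon_entropy N Y' = shannon_entropy M Y"
    "cond_entropy N X' Y' = cond_entropy M X Y"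
    "\<And>R. max_entropy R N X' Y' = max_entropy R M X Y"
  show ?thesis
    using assms(1) N(1) unfolding beta_h_admissible_def by (auto simp flip: N(2-4))
qed


subsection \<open>Existence of the least constants\<close>

lemma information_space_2: "prob_space M \<Longrightarrow> information_space M 2"
  by (simp add: information_space_def information_space_axioms_def)

lemma simple_function_lin_comb:
  assumes "rv_pair M X Y"
  shows "simple_function M (lin_comb X r Y)"
proof -
  have "simple_function M (\<lambda>\<omega>. (X \<omega>, Y \<omega>))"
    using assms by (auto simp: rv_pair_def intro: simple_function_Pair)
  from simple_function_compose[OF this, of "\<lambda>(x, y). of_int x + r * of_int y"]
  show ?thesis by (simp add: comp_def lin_comb_def)
qed

lemma cond_entropy_nonneg:
  assumes "prob_space M" "simple_function M X" "simple_function M Y"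
  shows "0 \<le> cond_entropy M X Y"
  using information_space.conditional_entropy_nonneg[OF information_space_2[OF assms(1)] assms(2,3)]
  by (simp add: cond_entropy_def)

lemma shannon_entropy_data_processing:
  assumes "prob_space M" "simple_function M X"
  shows "shannon_entropy M (\<lambda>\<omega>. f (X \<omega>)) \<le> shannon_entropy M X"
  using information_space.entropy_data_processing[OF information_space_2[OF assms(1)] assms(2), of f]
  by (simp add: shannon_entropy_def comp_def)

lemma shannon_entropy_chain_rule:
  assumes "prob_space M" "simple_function M X" "simple_function M Y"
  shows "shannon_entropy M (\<lambda>\<omega>. (X \<omega>, Y \<omega>)) = shannon_entropy M X + cond_entropy M Y X"
  using information_space.entropy_chain_rule[OF information_space_2[OF assms(1)] assms(2,3)]
  by (simp add: shannon_entropy_def cond_entropy_def)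

lemma cond_entropy_le:
  assumes "prob_space M" "simple_function M X" "simple_function M Y"
  shows "cond_entropy M X Y \<le> shannon_entropy M X"
  using information_space.conditional_entropy_less_eq_entropy
      [OF information_space_2[OF assms(1)] assms(2,3)]
  by (simp add: shannon_entropy_def cond_entropy_def)

lemma shannon_entropy_le_max_entropy:
  assumes "finite R" "r \<in> R"
  shows "shannon_entropy M (lin_comb X r Y) \<le> max_entropy R M X Y"
  unfolding max_entropy_def using assms by (intro Max_ge) auto

lemma cond_entropy_le_max_entropy:
  assumes "finite R" "r \<in> R" "rv_pair M X Y"
  shows "cond_entropy M X Y \<le> max_entropy R M X Y"
proof -
  have M: "prob_space M" and X: "simple_function M X" and Y: "simple_function M Y"
    using assms by (auto simp: rv_pair_def)
  note Z = simple_function_lin_comb[OF assms(3), of r]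
  have "shannon_entropy M Y + cond_entropy M X Y = shannon_entropy M (\<lambda>\<omega>. (Y \<omega>, X \<omega>))"
    using shannon_entropy_chain_rule[OF M Y X] by simp
  also have "\<dots> = shannon_entropy M
      (\<lambda>\<omega>. (\<lambda>(y, z). (y, \<lfloor>z - r * of_int y\<rfloor>)) (Y \<omega>, lin_comb X r Y \<omega>))"
    by (simp add: lin_comb_def)
  also have "\<dots> \<le> shannon_entropy M (\<lambda>\<omega>. (Y \<omega>, lin_comb X r Y \<omega>))"
    by (intro shannon_entropy_data_processing M simple_function_Pair Y Z)
  also have "\<dots> = shannon_entropy M Y + cond_entropy M (lin_comb X r Y) Y"
    by (rule shannon_entropy_chain_rule[OF M Y Z])
  also have "\<dots> \<le> shannon_entropy M Y + shannon_entropy M (lin_comb X r Y)"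
    using cond_entropy_le[OF M Z Y] by simp
  finally show ?thesis
    using shannon_entropy_le_max_entropy[OF assms(1,2), of M X Y] by simp
qed

lemma joint_entropy_le_max_entropy:
  assumes "finite R" "r \<in> R" "s \<in> R" "r \<noteq> s" "rv_pair M X Y"
  shows "shannon_entropy M Y + cond_entropy M X Y \<le> 2 * max_entropy R M X Y"
proof -
  have M: "prob_space M" and X: "simple_function M X" and Y: "simple_function M Y"
    using assms by (auto simp: rv_pair_def)
  note Zr = simple_function_lin_comb[OF assms(5), of r]
  note Zs = simple_function_lin_comb[OF assms(5), of s]
  define g where "g = (\<lambda>(u, v). let y = (u - v) / (r - s) in (\<lfloor>y\<rfloor>, \<lfloor>u - r * y\<rfloor>))"
  have g: "g (lin_comb X r Y \<omega>, lin_comb X s Y \<omega>) = (Y \<omega>, X \<omega>)" for \<omega>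
  proof -
    have "(lin_comb X r Y \<omega> - lin_comb X s Y \<omega>) / (r - s) = of_int (Y \<omega>)"
      using assms(4) by (simp add: lin_comb_def field_simps)
    then have "g (lin_comb X r Y \<omega>, lin_comb X s Y \<omega>) = (Y \<omega>, \<lfloor>lin_comb X r Y \<omega> - r * of_int (Y \<omega>)\<rfloor>)"
      by (simp only: g_def Let_def case_prod_conv floor_of_int)
    then show ?thesis by (simp add: lin_comb_def)
  qed
  have "shannon_entropy M Y + cond_entropy M X Y = shannon_entropy M (\<lambda>\<omega>. (Y \<omega>, X \<omega>))"
    using shannon_entropy_chain_rule[OF M Y X] by simp
  also have "\<dots> = shannon_entropy M (\<lambda>\<omega>. g (lin_comb X r Y \<omega>, lin_comb X s Y \<omega>))"
    by (simp add: g)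
  also have "\<dots> \<le> shannon_entropy M (\<lambda>\<omega>. (lin_comb X r Y \<omega>, lin_comb X s Y \<omega>))"
    by (intro shannon_entropy_data_processing M simple_function_Pair Zr Zs)
  also have "\<dots> = shannon_entropy M (lin_comb X r Y) + cond_entropy M (lin_comb X s Y) (lin_comb X r Y)"
    by (rule shannon_entropy_chain_rule[OF M Zr Zs])
  also have "\<dots> \<le> shannon_entropy M (lin_comb X r Y) + shannon_entropy M (lin_comb X s Y)"
    using cond_entropy_le[OF M Zs Zr] by simp
  finally show ?thesis
    using shannon_entropy_le_max_entropy[OF assms(1,2), of M X Y]
      shannon_entropy_le_max_entropy[OF assms(1,3), of M X Y] by simp
qed

lemma exists_max_entropy_gt:
  assumes "finite R" "r \<in> R" "r \<noteq> 0"
  obtains M :: "nat measure" and X Y where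
    "rv_pair M X Y" "cond_entropy M X Y < max_entropy R M X Y"
proof
  define M where "M = uniform_count_measure {0, 1 :: nat}"
  define X where "X = (\<lambda>_ :: nat. 0 :: int)"
  have M: "prob_space M"
    unfolding M_def by (intro prob_space_uniform_count_measure) auto
  interpret information_space M 2 by (rule information_space_2[OF M])
  have sp: "space M = {0, 1}" "sets M = Pow {0, 1}"
    by (simp_all add: M_def space_uniform_count_measure sets_uniform_count_measure)
  have sf: "simple_function M f" for f :: "nat \<Rightarrow> 'z"
    unfolding simple_function_def by (auto simp: sp)
  show rv: "rv_pair M X int" by (simp add: rv_pair_def M sf)
  note ent = entropy_simple_distributed[OF simple_distributedI[OF sf measure_nonneg refl]]
  have "X -` {0} \<inter> space M = space M" "X ` space M = {0}"
    by (auto simp: X_def sp)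
  then have "shannon_entropy M X = 0"
    unfolding shannon_entropy_def by (subst ent) (simp add: prob_space)
  then have 0: "cond_entropy M X int \<le> 0"
    using cond_entropy_le[OF M sf sf, of X int] by simp
  have p: "measure M {0} = 1/2" "measure M {Suc 0} = 1/2"
    by (simp_all add: M_def measure_uniform_count_measure)
  have pre: "lin_comb X r int -` {0} \<inter> space M = {0}" "lin_comb X r int -` {r} \<inter> space M = {Suc 0}"
    "lin_comb X r int ` space M = {0, r}"
    using assms(3) by (auto simp: lin_comb_def X_def sp)
  have "shannon_entropy M (lin_comb X r int) = 1"
    unfolding shannon_entropy_def
    using assms(3) by (subst ent) (simp add: pre p log_divide)
  moreover have "shannon_entropy M (lin_comb X r int) \<le> max_entropy R M X int"
    by (rule shannon_entropy_le_max_entropy) fact+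
  ultimately show "cond_entropy M X int < max_entropy R M X int" using 0 by simp
qed

lemma least_constant:
  fixes a m :: "'i \<Rightarrow> real"
  assumes nonneg: "\<And>i. i \<in> I \<Longrightarrow> 0 \<le> m i" and pos: "j \<in> I" "0 < m j"
    and c: "\<And>i. i \<in> I \<Longrightarrow> a i \<le> c * m i"
    and P: "\<And>b. P b \<longleftrightarrow> (\<forall>i\<in>I. a i \<le> b * m i)"
  shows "P (LEAST b. P b)" "P b \<Longrightarrow> (LEAST b. P b) \<le> b"
proof -
  have ge: "a i / m i \<le> b" if "P b" "i \<in> I" "0 < m i" for b i
    using that by (simp add: P pos_divide_le_eq)
  have Pc: "P c" using c by (simp add: P)
  have bdd: "bdd_below {b. P b}"
    by (rule bdd_belowI[of _ "a j / m j"]) (use ge pos in auto)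
  have PInf: "P (Inf {b. P b})"
    unfolding P[of "Inf _"]
  proof
    fix i assume i: "i \<in> I"
    show "a i \<le> Inf {b. P b} * m i"
    proof (cases "m i = 0")
      case True
      then show ?thesis using c[OF i] by simp
    next
      case False
      then have "0 < m i" using nonneg[OF i] by simp
      then have "a i / m i \<le> Inf {b. P b}"
        using Pc ge[OF _ i] by (intro cInf_greatest) auto
      then show ?thesis using \<open>0 < m i\<close> by (simp add: pos_divide_le_eq)
    qed
  qed
  have le: "Inf {b. P b} \<le> b" if "P b" for b
    using that bdd by (intro cInf_lower) auto
  have "(LEAST b. P b) = Inf {b. P b}"
    using PInf le by (rule Least_equality)
  then show "P (LEAST b. P b)" "P b \<Longrightarrow> (LEAST b. P b) \<le> b"
    using PInf le by simp_all
qed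

lemma obtain_distinct_slopes:
  fixes R :: "rat set"
  assumes "2 \<le> card R"
  obtains r s where "r \<in> R" "s \<in> R" "r \<noteq> s" "r \<noteq> 0"
proof -
  have "\<not> card R \<le> 1" using assms by simp
  then obtain r s where "r \<in> R" "s \<in> R" "r \<noteq> s"
    using assms by (metis card.infinite card_le_Suc0_iff_eq One_nat_def zero_le_one)
  then show thesis by (cases "r = 0") (use that in metis)+
qed

lemma
  assumes "finite R" "2 \<le> card R"
  shows beta_least: "beta_admissible R (beta R)" "beta_admissible R \<beta> \<Longrightarrow> beta R \<le> \<beta>"
    and beta_h_least: "beta_h_admissible R (beta_h R)" "beta_h_admissible R \<beta> \<Longrightarrow> beta_h R \<le> \<beta>"
proof -
  obtain r s where rs: "r \<in> R" "s \<in> R" "r \<noteq> s" "r \<noteq> 0"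
    using obtain_distinct_slopes[OF assms(2)] .
  obtain M0 :: "nat measure" and X0 Y0
    where 0: "rv_pair M0 X0 Y0" "cond_entropy M0 X0 Y0 < max_entropy R M0 X0 Y0"
    using exists_max_entropy_gt[OF assms(1) rs(1,4)] .
  define I :: "(nat measure \<times> (nat \<Rightarrow> int) \<times> (nat \<Rightarrow> int)) set"
    where "I = {(M, X, Y). rv_pair M X Y}"
  have nn: "0 \<le> cond_entropy M X Y" if "rv_pair M X Y" for M :: "nat measure" and X Y
    using that cond_entropy_nonneg by (auto simp: rv_pair_def)
  note cm = cond_entropy_le_max_entropy[OF assms(1) rs(1)]
  note jm = joint_entropy_le_max_entropy[OF assms(1) rs(1,2,3)]
  define a where "a = (\<lambda>(M :: nat measure, X :: nat \<Rightarrow> int, Y :: nat \<Rightarrow> int). shannon_entropy M Y)"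
  define m where "m = (\<lambda>(M :: nat measure, X, Y). max_entropy R M X Y)"
  define h where "h = (\<lambda>(M :: nat measure, X :: nat \<Rightarrow> int, Y :: nat \<Rightarrow> int). cond_entropy M X Y)"
  have h: "0 \<le> h i" "h i \<le> m i" "a i + h i \<le> 2 * m i" if "i \<in> I" for i
    using that nn cm jm by (auto simp: I_def a_def m_def h_def)
  have j: "(M0, X0, Y0) \<in> I" "h (M0, X0, Y0) < m (M0, X0, Y0)"
    using 0 by (simp_all add: I_def m_def h_def)
  have m: "0 \<le> m i" "a i \<le> 2 * m i" if "i \<in> I" for i
    using h[OF that] by auto
  have j': "0 < m (M0, X0, Y0)" using h(1)[OF j(1)] j(2) by simp
  have P: "beta_admissible R b \<longleftrightarrow> (\<forall>i\<in>I. a i \<le> b * m i)" for b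
    by (auto simp: beta_admissible_def I_def a_def m_def)
  show "beta_admissible R (beta R)" "beta_admissible R \<beta> \<Longrightarrow> beta R \<le> \<beta>"
    unfolding beta_def using least_constant[of I m, OF m(1) j(1) j' m(2) P] by blast+
  have mh: "0 \<le> m i - h i" "a i - h i \<le> 2 * (m i - h i)" if "i \<in> I" for i
    using h[OF that] by auto
  have jh: "0 < m (M0, X0, Y0) - h (M0, X0, Y0)" using j(2) by simp
  have "beta_h_admissible R b \<longleftrightarrow> (\<forall>i\<in>I. a i + (b - 1) * h i \<le> b * m i)" for b
    by (auto simp: beta_h_admissible_def I_def a_def m_def h_def)
  then have Ph: "beta_h_admissible R b \<longleftrightarrow> (\<forall>i\<in>I. a i - h i \<le> b * (m i - h i))" for b
    by (simp add: algebra_simps)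
  show "beta_h_admissible R (beta_h R)" "beta_h_admissible R \<beta> \<Longrightarrow> beta_h R \<le> \<beta>"
    unfolding beta_h_def
    using least_constant[of I "\<lambda>i. m i - h i", OF mh(1) j(1) jh mh(2) Ph] by blast+
qed

end

theory Submission
  imports Defs "HOL-Computational_Algebra.Polynomial" "HOL-Computational_Algebra.Primes"
begin

text \<open>
  Since \<open>beta R\<close> and \<open>beta_h R\<close> are at least 1 (take \<open>X = 0\<close> and a fair bit \<open>Y\<close>), the homogeneous
  inequality implies the plain one. For the converse put \<open>h = H(X | Y)\<close>; the goal is
  \<open>H(Y) - h \<le> \<beta> (max H(X + rY) - h)\<close>. Take \<open>n\<close> independent copies of \<open>(X, Y)\<close> and a linear map \<open>\<phi>\<close> over
  a large prime field whose range has about \<open>2^(nh)\<close> elements. For a suitable \<open>\<phi>\<close>, found by averaging,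
  \<open>H(\<phi> X | Y)\<close> is \<open>nh - O(sqrt n)\<close>. Condition on \<open>W = (\<phi> X, \<phi> Y)\<close>. As \<open>W\<close> takes at most about \<open>2^(2nh)\<close>
  values, \<open>H(Y | W) \<ge> n (H(Y) - h) - O(sqrt n)\<close>; as \<open>W\<close> determines \<open>\<phi> (X + rY)\<close>, whose entropy is
  at least \<open>H(\<phi> X | Y)\<close>, also \<open>H(X + rY | W) \<le> n (H(X + rY) - h) + O(sqrt n)\<close>. The plain inequality
  also holds for entropies conditioned on \<open>W\<close>, and dividing by \<open>n\<close> gives the claim.
\<close>

subsection \<open>Entropy of finite distributions\<close>

text \<open>The weights are strictly positive on the carrier, so every \<open>mass\<close> at a
  point of \<open>A\<close> is positive and its logarithm is meaningful.\<close>

definition fin_dist :: "'a set \<Rightarrow> ('a \<Rightarrow> real) \<Rightarrow> bool" where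
  "fin_dist A p \<longleftrightarrow> finite A \<and> (\<forall>a\<in>A. 0 < p a) \<and> sum p A = 1"

text \<open>The probability that \<open>f\<close> takes the same value as at \<open>a\<close>, so that
  entropy becomes an expected value over the sample space.\<close>

definition mass :: "'a set \<Rightarrow> ('a \<Rightarrow> real) \<Rightarrow> ('a \<Rightarrow> 'b) \<Rightarrow> 'a \<Rightarrow> real" where
  "mass A p f a = sum p {b \<in> A. f b = f a}"

definition ent :: "'a set \<Rightarrow> ('a \<Rightarrow> real) \<Rightarrow> ('a \<Rightarrow> 'b) \<Rightarrow> real" where
  "ent A p f = - (\<Sum>a\<in>A. p a * log 2 (mass A p f a))"

lemma mass_cong:
  assumes "\<And>b. b \<in> A \<Longrightarrow> f b = f a \<longleftrightarrow> g b = g a"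
  shows "mass A p f a = mass A p g a"
  unfolding mass_def using assms by (intro sum.cong) auto

lemma ent_cong:
  assumes "\<And>a b. a \<in> A \<Longrightarrow> b \<in> A \<Longrightarrow> f b = f a \<longleftrightarrow> g b = g a"
  shows "ent A p f = ent A p g"
  unfolding ent_def using assms by (auto intro!: sum.cong mass_cong arg_cong[where f = "log 2"])

lemma mass_if_eq: "f a = f b \<Longrightarrow> mass A p f a = mass A p f b"
  by (simp add: mass_def)

lemma mass_mono:
  assumes "fin_dist A p" "\<And>b. b \<in> A \<Longrightarrow> f b = f a \<Longrightarrow> g b = g a"
  shows "mass A p f a \<le> mass A p g a"
  unfolding mass_def using assms by (intro sum_mono2) (auto simp: fin_dist_def less_imp_le)

lemma mass_pos:
  assumes "fin_dist A p" "a \<in> A"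
  shows "0 < mass A p f a"
  unfolding mass_def using assms by (intro sum_pos) (auto simp: fin_dist_def)

text \<open>When \<open>f\<close> determines \<open>g\<close>, every fibre of \<open>f\<close> lies
  in a fibre of \<open>g\<close>, so passing to \<open>g\<close> only increases masses.\<close>

lemma ent_mono:
  assumes "fin_dist A p" "\<And>a b. a \<in> A \<Longrightarrow> b \<in> A \<Longrightarrow> f b = f a \<Longrightarrow> g b = g a"
  shows "ent A p g \<le> ent A p f"
  unfolding ent_def
  using assms mass_pos[OF assms(1), of _ f] mass_pos[OF assms(1), of _ g]
  by (intro le_imp_neg_le sum_mono mult_left_mono)
    (auto simp: fin_dist_def less_imp_le intro!: mass_mono[OF assms(1)])

lemma ent_nonneg:
  assumes "fin_dist A p"
  shows "0 \<le> ent A p f"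
proof -
  have "ent A p (\<lambda>_. ()) = 0"
    using assms by (simp add: ent_def mass_def fin_dist_def)
  then show ?thesis using ent_mono[OF assms, of f "\<lambda>_. ()"] by simp
qed

text \<open>From ln x \<le> x - 1. This is the case of Jensen's inequality behind the entropy bounds
  below: each of them picks a quotient of masses \<open>F\<close> with mean at most 1.\<close>

lemma gibbs:
  assumes "fin_dist A p" "\<And>a. a \<in> A \<Longrightarrow> 0 < F a" "(\<Sum>a\<in>A. p a * F a) \<le> 1"
  shows "(\<Sum>a\<in>A. p a * log 2 (F a)) \<le> 0"
proof -
  have "(\<Sum>a\<in>A. p a * log 2 (F a)) \<le> (\<Sum>a\<in>A. p a * ((F a - 1) / ln 2))"
    using assms(1,2) by (intro sum_mono mult_left_mono)
      (auto simp: fin_dist_def less_imp_le log_def divide_right_mono ln_le_minus_one)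
  also have "\<dots> = ((\<Sum>a\<in>A. p a * F a) - sum p A) / ln 2"
    by (simp add: sum_subtractf[symmetric] sum_divide_distrib algebra_simps)
  also have "\<dots> \<le> 0"
    using assms(1,3) by (simp add: fin_dist_def divide_nonpos_pos)
  finally show ?thesis .
qed

lemma sum_mass_quotient:
  assumes "fin_dist A p" "b \<in> A"
  shows "(\<Sum>a\<in>{a \<in> A. f a = f b}. p a / mass A p f a) = 1"
proof -
  have "(\<Sum>a\<in>{a \<in> A. f a = f b}. p a / mass A p f a) = (\<Sum>a\<in>{a \<in> A. f a = f b}. p a / mass A p f b)"
    by (intro sum.cong refl arg_cong2[where f = "(/)"] mass_if_eq) auto
  also have "\<dots> = mass A p f b / mass A p f b"
    unfolding mass_def by (rule sum_divide_distrib[symmetric])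
  finally show ?thesis using mass_pos[OF assms, of f] by simp
qed

text \<open>\<open>gibbs\<close> with \<open>F\<close> the inverse of mass times
  \<open>card T\<close>: each fibre of \<open>f\<close> contributes 1 to the sum of
  \<open>p a / mass A p f a\<close>, so this sum counts the values of \<open>f\<close>.\<close>

lemma ent_le_log_card:
  assumes "fin_dist A p" "finite T" "f ` A \<subseteq> T"
  shows "ent A p f \<le> log 2 (card T)"
proof -
  have fin: "finite A" and "A \<noteq> {}" using assms(1) by (auto simp: fin_dist_def)
  then have T: "0 < real (card T)" using assms(2,3) by (auto simp: card_gt_0_iff)
  have "(\<Sum>a\<in>A. p a * (1 / (mass A p f a * card T))) = (\<Sum>a\<in>A. p a / mass A p f a) / card T"
    by (simp add: sum_divide_distrib)
  also have "(\<Sum>a\<in>A. p a / mass A p f a) = (\<Sum>v\<in>f ` A. \<Sum>a\<in>{a \<in> A. f a = v}. p a / mass A p f a)"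
    by (rule sum.image_gen) (rule fin)
  also have "\<dots> = (\<Sum>v\<in>f ` A. 1)"
    by (intro sum.cong refl) (auto simp: sum_mass_quotient[OF assms(1)])
  also have "\<dots> / card T \<le> 1"
    using T assms(2,3) by (simp add: card_mono)
  finally have "(\<Sum>a\<in>A. p a * log 2 (1 / (mass A p f a * card T))) \<le> 0"
    using T by (intro gibbs assms(1)) (auto simp: mass_pos[OF assms(1)])
  also have "(\<Sum>a\<in>A. p a * log 2 (1 / (mass A p f a * card T)))
      = (\<Sum>a\<in>A. - (p a * log 2 (mass A p f a)) - p a * log 2 (card T))"
  proof (intro sum.cong refl)
    fix a assume "a \<in> A"
    then have "log 2 (1 / (mass A p f a * card T)) = - log 2 (mass A p f a) - log 2 (card T)"
      using T mass_pos[OF assms(1), of a f] by (subst log_divide) (auto simp: log_mult)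
    then show "p a * log 2 (1 / (mass A p f a * card T))
        = - (p a * log 2 (mass A p f a)) - p a * log 2 (card T)"
      by (simp only: right_diff_distrib mult_minus_right)
  qed
  also have "\<dots> = ent A p f - sum p A * log 2 (card T)"
    by (simp add: ent_def sum_subtractf sum_negf sum_distrib_right)
  finally show ?thesis using assms(1) by (simp add: fin_dist_def)
qed

text \<open>Nonnegativity of the mutual information of \<open>f\<close> and \<open>g\<close> given
  \<open>v\<close>, for \<open>v\<close> a common function of \<open>f\<close> and \<open>g\<close>.
  It follows from \<open>gibbs\<close> once the mean of the quotient \<open>?F\<close> is written as
  a sum over triples.\<close>

lemma ent_submodular:
  assumes "fin_dist A p"
    and "\<And>a b. a \<in> A \<Longrightarrow> b \<in> A \<Longrightarrow> f a = f b \<Longrightarrow> v a = v b"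
    and "\<And>a b. a \<in> A \<Longrightarrow> b \<in> A \<Longrightarrow> g a = g b \<Longrightarrow> v a = v b"
  shows "ent A p (\<lambda>a. (f a, g a)) + ent A p v \<le> ent A p f + ent A p g"
proof -
  let ?fg = "\<lambda>a. (f a, g a)"
  let ?m = "mass A p"
  note pos = mass_pos[OF assms(1)]
  have fin: "finite A" and p: "\<And>a. a \<in> A \<Longrightarrow> 0 < p a" using assms(1) by (auto simp: fin_dist_def)
  have m: "?m h a = (\<Sum>b\<in>A. if h b = h a then p b else 0)" for h :: "'a \<Rightarrow> 'z" and a
    using fin by (simp add: mass_def sum.inter_filter)
  \<comment> \<open>For fixed \<open>b\<close> and \<open>c\<close> the points \<open>a\<close> that
    count form a single fibre of \<open>(f, g)\<close> or none. If there is one, \<open>v\<close>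
    agrees at \<open>a\<close>, \<open>b\<close> and \<open>c\<close>, and the quotients
    \<open>p a / ?m ?fg a\<close> add up to 1.\<close>
  have inner: "(\<Sum>a\<in>A. if f b = f a \<and> g c = g a then p a / (?m ?fg a * ?m v a) else 0)
      \<le> (if v c = v b then 1 / ?m v b else 0)" if bc: "b \<in> A" "c \<in> A" for b c
  proof (cases "\<exists>d\<in>A. f b = f d \<and> g c = g d")
    case True
    then obtain d where d: "d \<in> A" "f b = f d" "g c = g d" by blast
    have v: "v d = v b" "v c = v b"
      using assms(2)[OF d(1) bc(1)] assms(3)[OF d(1) bc(2)] d by auto
    have "(\<Sum>a\<in>A. if f b = f a \<and> g c = g a then p a / (?m ?fg a * ?m v a) else 0)
        = (\<Sum>a\<in>{a \<in> A. ?fg a = ?fg d}. p a / (?m ?fg a * ?m v a))"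
      using d fin by (auto simp: sum.inter_filter intro!: sum.cong)
    also have "\<dots> = (\<Sum>a\<in>{a \<in> A. ?fg a = ?fg d}. p a / ?m ?fg a / ?m v b)"
    proof (intro sum.cong refl)
      fix a assume "a \<in> {a \<in> A. ?fg a = ?fg d}"
      then have "v a = v b" using assms(2)[of a d] d v by auto
      then have "?m v a = ?m v b" by (rule mass_if_eq)
      then show "p a / (?m ?fg a * ?m v a) = p a / ?m ?fg a / ?m v b" by simp
    qed
    also have "\<dots> = 1 / ?m v b"
      using sum_mass_quotient[OF assms(1) d(1), of ?fg] unfolding sum_divide_distrib[symmetric] by simp
    finally show ?thesis using v by simp
  next
    case False
    then have "(\<Sum>a\<in>A. if f b = f a \<and> g c = g a then p a / (?m ?fg a * ?m v a) else 0) = 0"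
      by (intro sum.neutral) auto
    then show ?thesis using pos[OF bc(1), of v] by auto
  qed
  have swap: "(\<Sum>a\<in>A. \<Sum>b\<in>A. \<Sum>c\<in>A. G a b c) = (\<Sum>b\<in>A. \<Sum>c\<in>A. \<Sum>a\<in>A. G a b c)"
    for G :: "'a \<Rightarrow> 'a \<Rightarrow> 'a \<Rightarrow> real"
    unfolding sum.swap[of "\<lambda>a b. \<Sum>c\<in>A. G a b c" A A] by (intro sum.cong refl sum.swap)
  let ?F = "\<lambda>a. ?m f a * ?m g a / (?m ?fg a * ?m v a)"
  have "(\<Sum>a\<in>A. p a * ?F a) = (\<Sum>a\<in>A. \<Sum>b\<in>A. \<Sum>c\<in>A.
      if f b = f a \<and> g c = g a then p b * p c * (p a / (?m ?fg a * ?m v a)) else 0)"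
  proof (intro sum.cong refl)
    fix a assume "a \<in> A"
    have "?m f a * ?m g a = (\<Sum>b\<in>A. \<Sum>c\<in>A. if f b = f a \<and> g c = g a then p b * p c else 0)"
      unfolding m[of f] m[of g] sum_product by (intro sum.cong refl) auto
    then have "p a * ?F a = (\<Sum>b\<in>A. \<Sum>c\<in>A. if f b = f a \<and> g c = g a then p b * p c else 0)
        * (p a / (?m ?fg a * ?m v a))"
      by simp
    also have "\<dots> = (\<Sum>b\<in>A. \<Sum>c\<in>A.
        if f b = f a \<and> g c = g a then p b * p c * (p a / (?m ?fg a * ?m v a)) else 0)"
      unfolding sum_distrib_right by (intro sum.cong refl) auto
    finally show "p a * ?F a = \<dots>" .
  qed
  also have "\<dots> = (\<Sum>b\<in>A. \<Sum>c\<in>A. \<Sum>a\<in>A.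
      if f b = f a \<and> g c = g a then p b * p c * (p a / (?m ?fg a * ?m v a)) else 0)"
    by (rule swap)
  also have "\<dots> = (\<Sum>b\<in>A. \<Sum>c\<in>A. p b * p c * (\<Sum>a\<in>A.
      if f b = f a \<and> g c = g a then p a / (?m ?fg a * ?m v a) else 0))"
    unfolding sum_distrib_left by (intro sum.cong refl) auto
  also have "\<dots> \<le> (\<Sum>b\<in>A. \<Sum>c\<in>A. p b * p c * (if v c = v b then 1 / ?m v b else 0))"
    using p by (intro sum_mono mult_left_mono inner) (auto simp: less_imp_le)
  also have "\<dots> = (\<Sum>b\<in>A. p b * (?m v b / ?m v b))"
    unfolding m[of v] sum_divide_distrib sum_distrib_left by (intro sum.cong refl) auto
  also have "\<dots> = sum p A"
    using pos[of _ v] by (intro sum.cong refl) (auto simp: less_le)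
  also have "\<dots> = 1" using assms(1) by (simp add: fin_dist_def)
  finally have "(\<Sum>a\<in>A. p a * log 2 (?F a)) \<le> 0"
    by (intro gibbs assms(1)) (auto intro!: divide_pos_pos mult_pos_pos pos)
  also have "(\<Sum>a\<in>A. p a * log 2 (?F a)) = (\<Sum>a\<in>A. p a * log 2 (?m f a) + p a * log 2 (?m g a)
      - p a * log 2 (?m ?fg a) - p a * log 2 (?m v a))"
    using pos[of _ f] pos[of _ g] pos[of _ ?fg] pos[of _ v]
    by (intro sum.cong refl) (simp add: log_divide_pos log_mult_pos algebra_simps)
  also have "\<dots> = ent A p ?fg + ent A p v - ent A p f - ent A p g"
    by (simp add: ent_def sum.distrib sum_subtractf)
  finally show ?thesis by simp
qed

lemma ent_Pair_le:
  assumes "fin_dist A p"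
  shows "ent A p (\<lambda>a. (f a, g a)) \<le> ent A p f + ent A p g"
  using ent_submodular[OF assms, of f "\<lambda>_. ()" g] ent_nonneg[OF assms, of "\<lambda>_. ()"] by simp

subsection \<open>Random hashing\<close>

lemma exists_le_average:
  fixes F :: "'i \<Rightarrow> real" and c :: real
  assumes "finite I" "I \<noteq> {}" "(\<Sum>i\<in>I. F i) \<le> card I * c"
  shows "\<exists>i\<in>I. F i \<le> c"
proof (rule ccontr)
  assume "\<not> (\<exists>i\<in>I. F i \<le> c)"
  then have "c < F i" if "i \<in> I" for i
    using that by (meson not_le)
  then have "(\<Sum>i\<in>I. c) < (\<Sum>i\<in>I. F i)" using assms(1,2) by (intro sum_strict_mono) auto
  then show False using assms(3) by simp
qed

text \<open>A linear bound for the logarithm replaces Jensen's inequality in the average over the hash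
  functions.\<close>

lemma exists_good_hash:
  fixes hash :: "'i \<Rightarrow> 'b \<Rightarrow> 'd" and q :: real
  assumes dist: "fin_dist A p" and I: "finite I" "I \<noteq> {}" and q: "0 < q"
    and coll: "\<And>a b. a \<in> A \<Longrightarrow> b \<in> A \<Longrightarrow> f a \<noteq> f b \<Longrightarrow>
      q * card {i \<in> I. hash i (f a) = hash i (f b)} \<le> real (card I)"
  obtains i where "i \<in> I"
    "ent A p (\<lambda>a. (f a, g a)) - ent A p (\<lambda>a. (hash i (f a), g a))
      \<le> 1 + (\<Sum>a\<in>A. p a * \<bar>log 2 (mass A p g a / mass A p (\<lambda>a. (f a, g a)) a) - log 2 q\<bar>)"
proof -
  let ?fg = "\<lambda>a. (f a, g a)" and ?hg = "\<lambda>i a. (hash i (f a), g a)"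
  let ?m = "mass A p"
  define S where "S a = log 2 (?m g a / ?m ?fg a)" for a
  note pos = mass_pos[OF dist]
  have fin: "finite A" and p: "\<And>a. a \<in> A \<Longrightarrow> 0 < p a" using dist by (auto simp: fin_dist_def)
  have cI: "0 < real (card I)" using I by (simp add: card_gt_0_iff)
  \<comment> \<open>The points with the hash value of \<open>a\<close> are those with
    \<open>f b = f a\<close>, always present, and genuine collisions, each of which occurs for at
    most a fraction \<open>1 / q\<close> of the hash functions.\<close>
  have avg_mass: "(\<Sum>i\<in>I. ?m (?hg i) a) \<le> card I * (?m ?fg a + ?m g a / q)" if a: "a \<in> A" for a
  proof -
    have "?m (?hg i) a \<le> ?m ?fg a + (\<Sum>b\<in>{b \<in> A. g b = g a}.
        if f b \<noteq> f a \<and> hash i (f b) = hash i (f a) then p b else 0)" for i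
    proof -
      have "?m (?hg i) a = (\<Sum>b\<in>{b \<in> A. g b = g a}. if hash i (f b) = hash i (f a) then p b else 0)"
        using fin unfolding mass_def by (auto simp: sum.inter_filter intro!: sum.cong)
      also have "\<dots> = (\<Sum>b\<in>{b \<in> A. g b = g a}. (if f b = f a then p b else 0) +
          (if f b \<noteq> f a \<and> hash i (f b) = hash i (f a) then p b else 0))"
        by (intro sum.cong refl) auto
 also note sum.distrib
      also have "(\<Sum>b\<in>{b \<in> A. g b = g a}. if f b = f a then p b else 0) = ?m ?fg a"
        using fin by (auto simp: mass_def sum.inter_filter[symmetric] intro!: sum.cong)
      finally show ?thesis by simp
    qed
    then have "(\<Sum>i\<in>I. ?m (?hg i) a) \<le> (\<Sum>i\<in>I. ?m ?fg a + (\<Sum>b\<in>{b \<in> A. g b = g a}.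
        if f b \<noteq> f a \<and> hash i (f b) = hash i (f a) then p b else 0))"
      by (rule sum_mono)
    also have "\<dots> = card I * ?m ?fg a + (\<Sum>b\<in>{b \<in> A. g b = g a}. \<Sum>i\<in>I.
        if f b \<noteq> f a \<and> hash i (f b) = hash i (f a) then p b else 0)"
      by (simp add: sum.distrib) (rule sum.swap)
    also have "(\<Sum>b\<in>{b \<in> A. g b = g a}. \<Sum>i\<in>I.
        if f b \<noteq> f a \<and> hash i (f b) = hash i (f a) then p b else 0)
        \<le> (\<Sum>b\<in>{b \<in> A. g b = g a}. p b * (card I / q))"
    proof (intro sum_mono)
      fix b assume b: "b \<in> {b \<in> A. g b = g a}"
      show "(\<Sum>i\<in>I. if f b \<noteq> f a \<and> hash i (f b) = hash i (f a) then p b else 0) \<le> p b * (card I / q)"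
      proof (cases "f b = f a")
        case True
        then show ?thesis using p[of b] b q by simp
      next
        case False
        then have "(\<Sum>i\<in>I. if f b \<noteq> f a \<and> hash i (f b) = hash i (f a) then p b else 0)
            = p b * card {i \<in> I. hash i (f b) = hash i (f a)}"
          using I by (simp add: sum.inter_filter[symmetric] mult.commute)
        also have "\<dots> \<le> p b * (card I / q)"
          using p[of b] b q coll[of b a] a False by (intro mult_left_mono) (auto simp: field_simps)
        finally show ?thesis .
      qed
    qed
    also have "\<dots> = card I * (?m g a / q)"
      unfolding mass_def sum_distrib_right[symmetric] by simp
    finally show ?thesis by (simp add: algebra_simps)
  qed
  have avg_log: "(\<Sum>i\<in>I. log 2 (?m (?hg i) a / ?m ?fg a)) \<le> card I * (1 + \<bar>S a - log 2 q\<bar>)"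
    if a: "a \<in> A" for a
  proof -
    define c where "c = ?m ?fg a + ?m g a / q"
    have c: "0 < c" unfolding c_def using pos[OF a, of ?fg] pos[OF a, of g] q by (intro add_pos_pos divide_pos_pos) auto
    have "(\<Sum>i\<in>I. log 2 (?m (?hg i) a / c)) \<le> (\<Sum>i\<in>I. (?m (?hg i) a / c - 1) / ln 2)"
      using pos[OF a, of "?hg i" for i] c by (intro sum_mono) (simp add: log_def divide_right_mono ln_le_minus_one)
    also have "\<dots> = ((\<Sum>i\<in>I. ?m (?hg i) a) / c - card I) / ln 2"
      by (simp add: sum_divide_distrib[symmetric] sum_subtractf)
    also have "\<dots> \<le> 0"
      using avg_mass[OF a] c by (simp add: divide_nonpos_pos c_def[symmetric] pos_divide_le_eq)
    finally have 1: "(\<Sum>i\<in>I. log 2 (?m (?hg i) a / c)) \<le> 0" .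
    have "(\<Sum>i\<in>I. log 2 (?m (?hg i) a / ?m ?fg a))
        = (\<Sum>i\<in>I. log 2 (?m (?hg i) a / c)) + card I * log 2 (c / ?m ?fg a)"
      using pos[OF a, of "?hg i" for i] pos[OF a, of ?fg] c
      by (simp add: log_divide_pos sum_subtractf algebra_simps)
    moreover have "log 2 (c / ?m ?fg a) \<le> 1 + \<bar>S a - log 2 q\<bar>"
    proof -
      have "c / ?m ?fg a = 1 + ?m g a / ?m ?fg a / q"
        using pos[OF a, of ?fg] by (simp add: c_def field_simps)
      also have "?m g a / ?m ?fg a / q = 2 powr (S a - log 2 q)"
        using pos[OF a, of ?fg] pos[OF a, of g] q by (simp add: S_def powr_diff)
      \<comment> \<open>Both summands are at most the power with the absolute value in the exponent;
        the factor 2 is the one bit lost in the conclusion.\<close>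
      also have "1 + \<dots> \<le> 2 * 2 powr \<bar>S a - log 2 q\<bar>"
      proof -
        have "2 powr (S a - log 2 q) \<le> 2 powr \<bar>S a - log 2 q\<bar>" by (intro powr_mono) auto
        moreover have "(1::real) \<le> 2 powr \<bar>S a - log 2 q\<bar>" by (intro ge_one_powr_ge_zero) auto
        ultimately show ?thesis by linarith
      qed
      finally have "log 2 (c / ?m ?fg a) \<le> log 2 (2 * 2 powr \<bar>S a - log 2 q\<bar>)"
        using c pos[OF a, of ?fg] by (subst log_le_cancel_iff) auto
      then show ?thesis by (simp add: log_mult_pos)
    qed
    ultimately show ?thesis
      using 1 mult_left_mono[of "log 2 (c / ?m ?fg a)" "1 + \<bar>S a - log 2 q\<bar>" "real (card I)"]
      by simp
  qed
  have diff: "ent A p ?fg - ent A p (?hg i) = (\<Sum>a\<in>A. p a * log 2 (?m (?hg i) a / ?m ?fg a))" for i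
    using pos[of _ ?fg] pos[of _ "?hg i"]
    by (simp add: ent_def sum_subtractf[symmetric] log_divide_pos right_diff_distrib)
  have "(\<Sum>i\<in>I. ent A p ?fg - ent A p (?hg i))
      = (\<Sum>a\<in>A. p a * (\<Sum>i\<in>I. log 2 (?m (?hg i) a / ?m ?fg a)))"
    unfolding diff by (subst sum.swap) (simp add: sum_distrib_left)
  also have "\<dots> \<le> (\<Sum>a\<in>A. p a * (card I * (1 + \<bar>S a - log 2 q\<bar>)))"
    using p by (intro sum_mono mult_left_mono avg_log) (auto simp: less_imp_le)
  also have "\<dots> = card I * (sum p A + (\<Sum>a\<in>A. p a * \<bar>S a - log 2 q\<bar>))"
    by (simp add: sum_distrib_left sum_distrib_right sum.distrib algebra_simps)
  finally have "(\<Sum>i\<in>I. ent A p ?fg - ent A p (?hg i))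
      \<le> card I * (1 + (\<Sum>a\<in>A. p a * \<bar>S a - log 2 q\<bar>))"
    using dist by (simp add: fin_dist_def)
  then show thesis
    using exists_le_average[OF I] that unfolding S_def by blast
qed

subsection \<open>Products and conditional laws\<close>

text \<open>The factors may be different laws: powers of one law give independent repetitions, mixed
  products combine the conditional laws belonging to different values of \<open>W\<close>.\<close>

fun prod_set :: "('a set \<times> ('a \<Rightarrow> real)) list \<Rightarrow> 'a list set" where
  "prod_set [] = {[]}"
| "prod_set ((A, p) # D) = (\<lambda>(a, l). a # l) ` (A \<times> prod_set D)"

text \<open>The default value 1 is the empty product; on \<open>prod_set D\<close> it is reached
  only when both lists are exhausted.\<close>

fun prod_wt :: "('a set \<times> ('a \<Rightarrow> real)) list \<Rightarrow> 'a list \<Rightarrow> real" where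
  "prod_wt ((A, p) # D) (a # l) = p a * prod_wt D l"
| "prod_wt _ _ = 1"

definition fin_dists :: "('a set \<times> ('a \<Rightarrow> real)) list \<Rightarrow> bool" where
  "fin_dists D \<longleftrightarrow> (\<forall>(A, p)\<in>set D. fin_dist A p)"

lemma fin_dists_simps [simp]:
  "fin_dists []" "fin_dists ((A, p) # D) \<longleftrightarrow> fin_dist A p \<and> fin_dists D"
  by (auto simp: fin_dists_def)

lemma sum_prod_set_Cons:
  "(\<Sum>l\<in>prod_set ((A, p) # D). G l) = (\<Sum>a\<in>A. \<Sum>l\<in>prod_set D. G (a # l))"
proof -
  have "inj_on (\<lambda>(a, l). a # l) (A \<times> prod_set D)" by (auto simp: inj_on_def)
  then show ?thesis
    by (simp add: sum.reindex sum.cartesian_product case_prod_unfold)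
qed

lemma length_prod_set: "l \<in> prod_set D \<Longrightarrow> length l = length D"
  by (induction D arbitrary: l rule: prod_set.induct) auto

lemma fin_dist_prod:
  assumes "fin_dists D"
  shows "fin_dist (prod_set D) (prod_wt D)"
  using assms
proof (induction D rule: prod_set.induct)
  case (2 A p D)
  then have IH: "fin_dist A p" "fin_dist (prod_set D) (prod_wt D)" by auto
  then have "sum (prod_wt ((A, p) # D)) (prod_set ((A, p) # D)) = 1"
    unfolding sum_prod_set_Cons by (simp add: sum_distrib_left[symmetric] fin_dist_def)
  with IH show ?case by (auto simp: fin_dist_def simp del: sum_prod_set_Cons)
qed (simp add: fin_dist_def)

lemma mass_prod_Cons:
  assumes "fin_dist A p" "fin_dists D"
  shows "mass (prod_set ((A, p) # D)) (prod_wt ((A, p) # D)) (map f) (a # l)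
    = mass A p f a * mass (prod_set D) (prod_wt D) (map f) l"
proof -
  have fin: "finite A" "finite (prod_set D)" "finite (prod_set ((A, p) # D))"
    using assms fin_dist_prod[OF assms(2)] by (auto simp: fin_dist_def)
  have m: "mass B q h a = (\<Sum>b\<in>B. if h b = h a then q b else 0)" if "finite B"
    for B q a and h :: "'z \<Rightarrow> 'w"
    using that by (simp add: mass_def sum.inter_filter)
  show ?thesis
    unfolding m[OF fin(1)] m[OF fin(2)] m[OF fin(3)] sum_prod_set_Cons sum_product
    by (intro sum.cong refl) auto
qed

lemma sum_product_add:
  assumes "fin_dist A p" "fin_dist B q"
  shows "(\<Sum>a\<in>A. \<Sum>b\<in>B. p a * q b * (F a + G b)) = (\<Sum>a\<in>A. p a * F a) + (\<Sum>b\<in>B. q b * G b)"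
proof -
  have "(\<Sum>a\<in>A. \<Sum>b\<in>B. p a * q b * (F a + G b))
      = (\<Sum>a\<in>A. p a * F a * sum q B + p a * (\<Sum>b\<in>B. q b * G b))"
    by (simp add: sum_distrib_left sum.distrib[symmetric] algebra_simps)
  also have "\<dots> = (\<Sum>a\<in>A. p a * F a) * sum q B + sum p A * (\<Sum>b\<in>B. q b * G b)"
    by (simp add: sum.distrib sum_distrib_right)
  finally show ?thesis using assms by (simp add: fin_dist_def)
qed

lemma ent_prod:
  assumes "fin_dists D"
  shows "ent (prod_set D) (prod_wt D) (map f) = (\<Sum>(A, p)\<leftarrow>D. ent A p f)"
  using assms
proof (induction D rule: prod_set.induct)
  case 1
  then show ?case by (simp add: ent_def mass_def)
next
  case (2 A p D)
  then have d: "fin_dist A p" "fin_dists D" "fin_dist (prod_set D) (prod_wt D)"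
    by (auto intro: fin_dist_prod)
  have "ent (prod_set ((A, p) # D)) (prod_wt ((A, p) # D)) (map f)
      = - (\<Sum>a\<in>A. \<Sum>l\<in>prod_set D. p a * prod_wt D l *
          (log 2 (mass A p f a) + log 2 (mass (prod_set D) (prod_wt D) (map f) l)))"
    unfolding ent_def sum_prod_set_Cons mass_prod_Cons[OF d(1,2)]
    using mass_pos[OF d(1), of _ f] mass_pos[OF d(3), of _ "map f"]
    by (simp add: log_mult_pos)
  also have "\<dots> = ent A p f + ent (prod_set D) (prod_wt D) (map f)"
    unfolding sum_product_add[OF d(1,3)] by (simp add: ent_def)
  finally show ?case using 2 by simp
qed

lemma mass_cond:
  assumes "fin_dist A p" "a \<in> A" "W a = w"
  shows "mass {b \<in> A. W b = w} (\<lambda>b. p b / sum p {b \<in> A. W b = w}) f a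
    = mass A p (\<lambda>a. (f a, W a)) a / mass A p W a"
proof -
  have "{b \<in> {b \<in> A. W b = w}. f b = f a} = {b \<in> A. (f b, W b) = (f a, W a)}"
    using assms(3) by auto
  then show ?thesis
    using assms(3) by (simp only: mass_def sum_divide_distrib)
qed

lemma fin_dist_cond:
  assumes "fin_dist A p" "w \<in> W ` A"
  shows "fin_dist {b \<in> A. W b = w} (\<lambda>b. p b / sum p {b \<in> A. W b = w})"
proof -
  have "0 < sum p {b \<in> A. W b = w}"
    using assms by (intro sum_pos) (auto simp: fin_dist_def)
  then show ?thesis
    using assms(1) by (auto simp: fin_dist_def simp flip: sum_divide_distrib)
qed

text \<open>The chain rule. The difference on the left is the form in which H(f | W) is used
  throughout; grouping its sum by the value of \<open>W\<close> turns it into the average of the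
  entropies under the conditional laws.\<close>

lemma cond_ent_eq:
  assumes "fin_dist A p"
  shows "ent A p (\<lambda>a. (f a, W a)) - ent A p W
    = (\<Sum>w\<in>W ` A. sum p {b \<in> A. W b = w} *
        ent {b \<in> A. W b = w} (\<lambda>b. p b / sum p {b \<in> A. W b = w}) f)"
proof -
  note pos = mass_pos[OF assms]
  have fin: "finite A" using assms by (simp add: fin_dist_def)
  have "ent A p (\<lambda>a. (f a, W a)) - ent A p W
      = - (\<Sum>a\<in>A. p a * log 2 (mass A p (\<lambda>a. (f a, W a)) a / mass A p W a))"
    using pos[of _ "\<lambda>a. (f a, W a)"] pos[of _ W]
    by (simp add: ent_def sum_subtractf log_divide_pos right_diff_distrib)
  also have "\<dots> = (\<Sum>w\<in>W ` A. - (\<Sum>a\<in>{a \<in> A. W a = w}.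
      p a * log 2 (mass A p (\<lambda>a. (f a, W a)) a / mass A p W a)))"
    unfolding sum_negf by (subst sum.image_gen[OF fin, of _ W]) simp
  also have "\<dots> = (\<Sum>w\<in>W ` A. sum p {b \<in> A. W b = w} *
      ent {b \<in> A. W b = w} (\<lambda>b. p b / sum p {b \<in> A. W b = w}) f)"
  proof (intro sum.cong refl)
    fix w assume w: "w \<in> W ` A"
    have P: "0 < sum p {b \<in> A. W b = w}"
      using assms w by (intro sum_pos) (auto simp: fin_dist_def)
    show "- (\<Sum>a\<in>{a \<in> A. W a = w}. p a * log 2 (mass A p (\<lambda>a. (f a, W a)) a / mass A p W a))
      = sum p {b \<in> A. W b = w} * ent {b \<in> A. W b = w} (\<lambda>b. p b / sum p {b \<in> A. W b = w}) f"
      unfolding ent_def sum_distrib_left mult_minus_right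
      using P by (intro arg_cong[where f = uminus] sum.cong refl) (auto simp: mass_cond[OF assms])
  qed
  finally show ?thesis .
qed

subsection \<open>Transfer to Shannon entropy\<close>

text \<open>All functions of \<open>Z\<close> are read off the law of \<open>Z\<close>. Values of
  probability zero are removed to satisfy \<open>fin_dist\<close>; they contribute nothing to the
  entropy.\<close>

lemma shannon_entropy_eq_ent:
  assumes "prob_space M" "simple_function M Z"
  defines "p \<equiv> \<lambda>z. measure M (Z -` {z} \<inter> space M)"
  shows "fin_dist {z \<in> Z ` space M. 0 < p z} p"
    and "shannon_entropy M (\<lambda>\<omega>. f (Z \<omega>)) = ent {z \<in> Z ` space M. 0 < p z} p f"
proof -
  interpret information_space M 2 by (rule information_space_2) fact
  let ?A = "{z \<in> Z ` space M. 0 < p z}"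
  have finZ: "finite (Z ` space M)" using assms(2) by (rule simple_functionD)
  have pre: "measure M ((\<lambda>\<omega>. g (Z \<omega>)) -` {v} \<inter> space M) = sum p {z \<in> ?A. g z = v}"
    for g :: "'b \<Rightarrow> 'z" and v
  proof -
    have "measure M ((\<lambda>\<omega>. g (Z \<omega>)) -` {v} \<inter> space M)
        = measure M (\<Union>z\<in>{z \<in> Z ` space M. g z = v}. Z -` {z} \<inter> space M)"
      by (intro arg_cong[where f = "measure M"]) auto
    also have "\<dots> = (\<Sum>z\<in>{z \<in> Z ` space M. g z = v}. p z)"
      unfolding p_def
      by (intro finite_measure_finite_Union)
        (auto simp: finZ disjoint_family_on_def intro: simple_functionD[OF assms(2)])
    also have "\<dots> = sum p {z \<in> ?A. g z = v}"
      by (intro sum.mono_neutral_right) (auto simp: finZ p_def measure_nonneg less_le)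
    finally show ?thesis .
  qed
  show "fin_dist ?A p"
    using pre[of "\<lambda>_. ()" "()"] finZ by (simp add: fin_dist_def prob_space vimage_def)
  have sf: "simple_function M (\<lambda>\<omega>. f (Z \<omega>))"
    using simple_function_compose[OF assms(2), of f] by (simp add: comp_def)
  have fv: "(\<lambda>\<omega>. f (Z \<omega>)) ` space M = f ` Z ` space M" by auto
  have "shannon_entropy M (\<lambda>\<omega>. f (Z \<omega>))
      = - (\<Sum>v\<in>f ` Z ` space M. sum p {z \<in> ?A. f z = v} * log 2 (sum p {z \<in> ?A. f z = v}))"
    unfolding shannon_entropy_def
    by (subst entropy_simple_distributed[OF simple_distributedI[OF sf measure_nonneg refl]])
      (simp add: pre fv)
  also have "(\<Sum>v\<in>f ` Z ` space M. sum p {z \<in> ?A. f z = v} * log 2 (sum p {z \<in> ?A. f z = v}))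
      = (\<Sum>v\<in>f ` Z ` space M. \<Sum>z\<in>{z \<in> ?A. f z = v}. p z * log 2 (mass ?A p f z))"
    unfolding sum_distrib_right by (intro sum.cong refl) (auto simp: mass_def)
  also have "\<dots> = (\<Sum>z\<in>?A. p z * log 2 (mass ?A p f z))"
    using finZ by (intro sum.group) auto
  finally show "shannon_entropy M (\<lambda>\<omega>. f (Z \<omega>)) = ent ?A p f"
    by (simp add: ent_def)
qed

text \<open>The passage back: an abstract \<open>fin_dist\<close> becomes a probability space, to
  which admissibility applies.\<close>

lemma shannon_entropy_point_measure:
  assumes "fin_dist A p"
  shows "prob_space (point_measure A p)"
    and "shannon_entropy (point_measure A p) f = ent A p f"
proof -
  show P: "prob_space (point_measure A p)"
    using assms by (intro prob_space_point_measure) (auto simp: fin_dist_def less_imp_le)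
  have sf: "simple_function (point_measure A p) (\<lambda>a. a)"
    using assms by (simp add: fin_dist_def)
  have m: "measure (point_measure A p) ((\<lambda>a. a) -` {a} \<inter> space (point_measure A p)) = p a"
    if "a \<in> A" for a
    using assms that
    by (subst measure_point_measure_finite_if)
      (auto simp: fin_dist_def less_imp_le space_point_measure vimage_def Int_absorb2)
  show "shannon_entropy (point_measure A p) f = ent A p f"
    unfolding shannon_entropy_eq_ent(2)[OF P sf, of f]
    using assms m by (auto simp: ent_def mass_def space_point_measure fin_dist_def
      intro!: sum.cong arg_cong[where f = "log 2"])
qed

lemma beta_admissible_ent:
  assumes "beta_admissible R \<beta>" "fin_dist A p"
  shows "ent A p Y \<le> \<beta> * (MAX r\<in>R. ent A p (lin_comb X r Y))"
proof -
  have "rv_pair (point_measure A p) X Y"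
    using shannon_entropy_point_measure(1)[OF assms(2)] assms(2)
    by (simp add: rv_pair_def fin_dist_def)
  from beta_admissible_D[OF assms(1) this] show ?thesis
    by (simp add: max_entropy_def shannon_entropy_point_measure[OF assms(2)])
qed

subsection \<open>Encoding vectors of integers by single integers\<close>

text \<open>Distinct lists of equal length are coefficient lists of distinct polynomials. The
  finitely many differences have finitely many roots, and any integer \<open>B\<close> avoiding them
  works. Equal length matters because \<open>Poly\<close> does not see trailing zeros.\<close>

lemma exists_horner_inj:
  fixes D :: "rat list set"
  assumes "finite D" "\<And>l. l \<in> D \<Longrightarrow> length l = n"
  obtains B :: int where "inj_on (horner_sum id (of_int B)) D"
proof -
  define S where "S = (\<Union>l\<in>D. \<Union>l'\<in>D - {l}. {x. poly (Poly l - Poly l') x = 0})"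
  have ne: "Poly l - Poly l' \<noteq> 0" if "l \<in> D" "l' \<in> D - {l}" for l l'
  proof
    assume "Poly l - Poly l' = 0"
    then have eq: "nth_default 0 l = nth_default 0 l'" by (metis coeff_Poly_eq eq_iff_diff_eq_0)
    have len: "length l = length l'" using that assms(2) by auto
    have "l = l'"
      by (rule nth_equalityI[OF len]) (use fun_cong[OF eq] len in \<open>simp add: nth_default_nth\<close>,
        metis nth_default_nth)
    then show False using that by simp
  qed
  have "finite S"
    unfolding S_def by (intro finite_UN_I poly_roots_finite ne) (use assms(1) in auto)
  then have "finite ((of_int :: int \<Rightarrow> rat) -` S)"
    by (rule finite_vimageI) (simp add: inj_on_def)
  then obtain B :: int where B: "of_int B \<notin> S"
    using ex_new_if_finite[of "(of_int :: int \<Rightarrow> rat) -` S"] infinite_UNIV_int by auto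
  have h: "horner_sum id x l = poly (Poly l) x" for x :: rat and l
    by (induction l) simp_all
  have "inj_on (horner_sum id (of_int B)) D"
    using B by (auto simp: inj_on_def h S_def)
  then show thesis by (rule that)
qed

text \<open>Evaluation at \<open>B\<close> is linear, so it commutes with forming X + rY. Tuples of
  pairs thus become one pair of integer variables without changing which values of Y or of X + rY
  coincide.\<close>

lemma exists_integer_encoding:
  assumes R: "finite R" and D: "fin_dists D"
  shows "\<exists>(X' :: 'a list \<Rightarrow> int) Y'. \<forall>l\<in>prod_set D. \<forall>l'\<in>prod_set D.
    (Y' l' = Y' l \<longleftrightarrow> map Y l' = map Y l) \<and>
    (\<forall>r\<in>R. lin_comb X' r Y' l' = lin_comb X' r Y' l \<longleftrightarrow> map (lin_comb X r Y) l' = map (lin_comb X r Y) l)"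
proof -
  let ?A = "prod_set D"
  have fin: "finite ?A" using fin_dist_prod[OF D] by (simp add: fin_dist_def)
  \<comment> \<open>One \<open>B\<close> must separate the values of \<open>Y\<close> and of X + rY
    for every \<open>r\<close> in \<open>R\<close> at once; all of them are treated as rational
    vectors.\<close>
  define V where "V = (\<lambda>l. map rat_of_int (map Y l)) ` ?A \<union> (\<Union>r\<in>R. map (lin_comb X r Y) ` ?A)"
  have "finite V" "\<And>v. v \<in> V \<Longrightarrow> length v = length D"
    using fin R by (auto simp: V_def length_prod_set)
  then obtain B :: int where B: "inj_on (horner_sum id (of_int B)) V"
    using exists_horner_inj by blast
  define e where "e Z l = horner_sum Z B l" for Z :: "'a \<Rightarrow> int" and l
  have eY: "of_int (e Y l) = horner_sum id (of_int B) (map rat_of_int (map Y l))" for l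
    by (induction l) (simp_all add: e_def)
  have eX: "lin_comb (e X) r (e Y) l = horner_sum id (of_int B) (map (lin_comb X r Y) l)" for r l
  proof (induction l)
    case Nil
    then show ?case by (simp add: e_def lin_comb_def)
  next
    case (Cons a l)
    have "lin_comb (e X) r (e Y) (a # l) = lin_comb X r Y a + of_int B * lin_comb (e X) r (e Y) l"
      by (simp add: e_def lin_comb_def algebra_simps)
    with Cons show ?case by simp
  qed
  show ?thesis
  proof (rule exI[of _ "e X"], rule exI[of _ "e Y"], intro ballI conjI)
    fix l l' assume l: "l \<in> ?A" "l' \<in> ?A"
    have "e Y l' = e Y l \<longleftrightarrow> rat_of_int (e Y l') = of_int (e Y l)" by simp
    also have "\<dots> \<longleftrightarrow> map rat_of_int (map Y l') = map rat_of_int (map Y l)"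
      unfolding eY by (rule inj_on_eq_iff[OF B]) (auto simp: V_def l)
    also have "\<dots> \<longleftrightarrow> map Y l' = map Y l"
      by (rule inj_eq) (simp add: inj_on_def)
    finally show "e Y l' = e Y l \<longleftrightarrow> map Y l' = map Y l" .
  next
    fix l l' r assume l: "l \<in> ?A" "l' \<in> ?A" and "r \<in> R"
    then show "lin_comb (e X) r (e Y) l' = lin_comb (e X) r (e Y) l
        \<longleftrightarrow> map (lin_comb X r Y) l' = map (lin_comb X r Y) l"
      unfolding eX using l by (intro inj_on_eq_iff[OF B]) (auto simp: V_def)
  qed
qed

text \<open>The inequality is applied to an independent product, where entropies add. Hence the
  maximum over \<open>R\<close> is taken after summation, which is stronger than summing the
  inequalities of the factors.\<close>

lemma beta_admissible_sum_list:
  assumes adm: "beta_admissible R \<beta>" and R: "finite R" and D: "fin_dists D"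
  shows "(\<Sum>(A, p)\<leftarrow>D. ent A p Y) \<le> \<beta> * (MAX r\<in>R. (\<Sum>(A, p)\<leftarrow>D. ent A p (lin_comb X r Y)))"
proof -
  let ?A = "prod_set D" and ?p = "prod_wt D"
  obtain X' Y' :: "'a list \<Rightarrow> int" where e: "\<forall>l\<in>?A. \<forall>l'\<in>?A.
      (Y' l' = Y' l \<longleftrightarrow> map Y l' = map Y l) \<and> (\<forall>r\<in>R. lin_comb X' r Y' l' = lin_comb X' r Y' l
        \<longleftrightarrow> map (lin_comb X r Y) l' = map (lin_comb X r Y) l)"
    using exists_integer_encoding[OF R D, of Y X] by blast
  have "ent ?A ?p Y' = ent ?A ?p (map Y)"
    using e by (intro ent_cong) blast
  moreover have "ent ?A ?p (lin_comb X' r Y') = ent ?A ?p (map (lin_comb X r Y))"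
    if "r \<in> R" for r
    using e that by (intro ent_cong) blast
  ultimately show ?thesis
    using beta_admissible_ent[OF adm fin_dist_prod[OF D], of Y' X'] by (simp add: ent_prod[OF D])
qed

subsection \<open>The inequality for conditional entropies\<close>

lemma nonpos_if_multiples_bounded:
  fixes x c :: real
  assumes "\<And>n::nat. real n * x \<le> c"
  shows "x \<le> 0"
proof (rule ccontr)
  assume "\<not> x \<le> 0"
  then obtain n :: nat where "c < n * x" using reals_Archimedean3[of x] by auto
  then show False using assms[of n] by simp
qed

text \<open>Applying the inequality to each conditional law separately would put the maximum inside the
  average over \<open>W\<close>. Instead it is applied once to a product containing about \<open>N * P (W = w)\<close> copies
  of the law conditioned on \<open>W = w\<close>.\<close>

lemma beta_admissible_cond:
  assumes adm: "beta_admissible R \<beta>" "finite R" "R \<noteq> {}" "0 \<le> \<beta>" and dist: "fin_dist A p"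
    and m: "\<And>r. r \<in> R \<Longrightarrow> ent A p (\<lambda>a. (lin_comb X r Y a, W a)) - ent A p W \<le> m"
  shows "ent A p (\<lambda>a. (Y a, W a)) - ent A p W \<le> \<beta> * m"
proof -
  define P where "P w = sum p {b \<in> A. W b = w}" for w
  define L where "L w = ({b \<in> A. W b = w}, \<lambda>b. p b / P w)" for w
  define H where "H f w = ent {b \<in> A. W b = w} (\<lambda>b. p b / P w) f" for w and f :: "'a \<Rightarrow> rat"
  define HY where "HY w = ent {b \<in> A. W b = w} (\<lambda>b. p b / P w) Y" for w
  have fin: "finite (W ` A)" using dist by (simp add: fin_dist_def)
  then obtain ws where ws: "set ws = W ` A" "distinct ws" using finite_distinct_list by blast
  have P: "0 \<le> P w" for w
    using dist unfolding P_def by (intro sum_nonneg) (auto simp: fin_dist_def less_imp_le)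
  have H: "0 \<le> H f w" "0 \<le> HY w" if "w \<in> W ` A" for f w
    using fin_dist_cond[OF dist that] unfolding H_def HY_def P_def by (auto intro: ent_nonneg)
  have "real N * (ent A p (\<lambda>a. (Y a, W a)) - ent A p W - \<beta> * m) \<le> (\<Sum>w\<in>W ` A. HY w)" for N :: nat
  proof -
    \<comment> \<open>Rounding down keeps the upper bound on the right side intact. On the left it
      costs at most one copy of each conditional entropy of \<open>Y\<close>, an error independent
      of \<open>N\<close>.\<close>
    define c where "c w = nat \<lfloor>N * P w\<rfloor>" for w
    have c: "real (c w) \<le> N * P w" "N * P w - 1 \<le> c w" for w
      unfolding c_def using P[of w] by auto
    define D where "D = concat (map (\<lambda>w. replicate (c w) (L w)) ws)"
    have D: "fin_dists D"
      unfolding D_def fin_dists_def using fin_dist_cond[OF dist, of _ W] by (auto simp: L_def P_def ws)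
    have sumD: "(\<Sum>d\<leftarrow>D. G d) = (\<Sum>w\<in>W ` A. c w * G (L w))" for G :: "_ \<Rightarrow> real"
    proof -
      have "(\<Sum>d\<leftarrow>D. G d) = (\<Sum>w\<leftarrow>ws. c w * G (L w))"
        unfolding D_def by (induction ws) (simp_all add: sum_list_replicate)
      then show ?thesis by (simp add: sum.distinct_set_conv_list[OF ws(2)] flip: ws(1))
    qed
    have "N * (ent A p (\<lambda>a. (Y a, W a)) - ent A p W) - (\<Sum>w\<in>W ` A. HY w)
        = (\<Sum>w\<in>W ` A. (N * P w - 1) * HY w)"
      unfolding cond_ent_eq[OF dist] HY_def P_def[symmetric]
      by (simp add: sum_distrib_left sum_subtractf algebra_simps)
    also have "\<dots> \<le> (\<Sum>w\<in>W ` A. c w * HY w)"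
      by (intro sum_mono mult_right_mono c H)
    also have "\<dots> = (\<Sum>(A, p)\<leftarrow>D. ent A p Y)"
      by (simp add: sumD L_def HY_def)
    also have "\<dots> \<le> \<beta> * (MAX r\<in>R. (\<Sum>(A, p)\<leftarrow>D. ent A p (lin_comb X r Y)))"
      by (rule beta_admissible_sum_list[OF adm(1,2) D])
    also have "\<dots> \<le> \<beta> * (N * m)"
    proof (intro mult_left_mono adm(4))
      have "(\<Sum>(A, p)\<leftarrow>D. ent A p (lin_comb X r Y)) \<le> N * m" if r: "r \<in> R" for r
      proof -
        have "(\<Sum>(A, p)\<leftarrow>D. ent A p (lin_comb X r Y)) = (\<Sum>w\<in>W ` A. c w * H (lin_comb X r Y) w)"
          by (simp add: sumD L_def H_def)
        also have "\<dots> \<le> (\<Sum>w\<in>W ` A. N * P w * H (lin_comb X r Y) w)"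
          by (intro sum_mono mult_right_mono c H)
        also have "\<dots> = N * (ent A p (\<lambda>a. (lin_comb X r Y a, W a)) - ent A p W)"
          unfolding cond_ent_eq[OF dist] H_def P_def[symmetric] by (simp add: sum_distrib_left mult.assoc)
        also have "\<dots> \<le> N * m" by (intro mult_left_mono m r) simp
        finally show ?thesis .
      qed
      then show "(MAX r\<in>R. (\<Sum>(A, p)\<leftarrow>D. ent A p (lin_comb X r Y))) \<le> N * m"
        using adm(2,3) by simp
    qed
    finally show ?thesis by (simp add: algebra_simps)
  qed
  then have "ent A p (\<lambda>a. (Y a, W a)) - ent A p W - \<beta> * m \<le> 0"
    by (rule nonpos_if_multiples_bounded)
  then show ?thesis by simp
qed

subsection \<open>Linear hash functions over a prime field\<close>

definition dot :: "int list \<Rightarrow> int list \<Rightarrow> int" where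
  "dot a x = sum_list (map2 (*) a x)"

definition vecs :: "nat \<Rightarrow> nat \<Rightarrow> int list set" where
  "vecs q n = {a. set a \<subseteq> {0..<int q} \<and> length a = n}"

text \<open>\<open>M\<close> lists the rows of a matrix over the field with \<open>q\<close>
  elements; the argument is an integer vector, reduced only after the multiplication.\<close>

definition lin_hash :: "nat \<Rightarrow> int list list \<Rightarrow> int list \<Rightarrow> int list" where
  "lin_hash q M x = map (\<lambda>a. dot a x mod int q) M"

lemma finite_vecs: "finite (vecs q n)"
  unfolding vecs_def by (rule finite_lists_length_eq) simp

lemma card_vecs: "card (vecs q n) = q ^ n"
  unfolding vecs_def by (subst card_lists_length_eq) simp_all

lemma vecs_Suc: "vecs q (Suc n) = (\<lambda>(c, a). c # a) ` ({0..<int q} \<times> vecs q n)"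
  by (auto simp: vecs_def length_Suc_conv image_iff)

lemma dot_simps [simp]:
  "dot [] x = 0" "dot a [] = 0" "dot (c # a) (u # x) = c * u + dot a x"
  by (simp_all add: dot_def)

lemma dot_linear: "dot a (map (\<lambda>i. s * f i + t * g i) l) = s * dot a (map f l) + t * dot a (map g l)"
proof (induction l arbitrary: a)
  case (Cons i l)
  then show ?case by (cases a) (simp_all add: algebra_simps)
qed simp

text \<open>A nontrivial linear equation over the field with \<open>q\<close> elements cuts the
  number of vectors by a factor of at least \<open>q\<close>. If \<open>q\<close> divides the
  leading coefficient, the first coordinate is free and induction applies; otherwise the other
  coordinates determine it.\<close>

lemma card_dot_dvd:
  assumes q: "prime q" and "\<exists>u\<in>set d. \<not> int q dvd u"
  shows "q * card {a \<in> vecs q (length d). int q dvd dot a d} \<le> q ^ length d"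
  using assms(2)
proof (induction d)
  case (Cons u d)
  let ?S = "{a \<in> vecs q (length (u # d)). int q dvd dot a (u # d)}"
  have q': "prime (int q)" using q by simp
  show ?case
  proof (cases "int q dvd u")
    case True
    let ?T = "{a \<in> vecs q (length d). int q dvd dot a d}"
    have "int q dvd c * u + dot a d \<longleftrightarrow> int q dvd dot a d" for c a
      using True by (simp add: dvd_add_right_iff)
    then have "?S = (\<lambda>(c, a). c # a) ` ({0..<int q} \<times> ?T)"
      by (auto simp: vecs_Suc)
    also have "card \<dots> = q * card ?T"
      by (subst card_image) (auto simp: inj_on_def card_cartesian_product)
    finally have "card ?S = q * card ?T" .
    moreover have "\<exists>u\<in>set d. \<not> int q dvd u" using True Cons.prems by auto
    ultimately show ?thesis using Cons.IH by simp
  next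
    case False
    have "inj_on tl ?S"
    proof (rule inj_onI)
      fix a b assume a: "a \<in> ?S" and b: "b \<in> ?S" and tl: "tl a = tl b"
      obtain c a' where a': "a = c # a'" "0 \<le> c" "c < int q" "int q dvd c * u + dot a' d"
        using a by (auto simp: vecs_Suc)
      obtain e where e: "b = e # a'" "0 \<le> e" "e < int q" "int q dvd e * u + dot a' d"
        using b tl a' by (auto simp: vecs_Suc)
      have "int q dvd (c * u + dot a' d) - (e * u + dot a' d)"
        using a'(4) e(4) by (rule dvd_diff)
      then have "int q dvd (c - e) * u" by (simp add: algebra_simps)
      then have "int q dvd c - e" using False q' by (simp add: prime_dvd_mult_iff)
      then have "c mod int q = e mod int q" by (simp add: mod_eq_dvd_iff)
      then show "a = b" using a' e by simp
    qed
    moreover have "tl ` ?S \<subseteq> vecs q (length d)" by (auto simp: vecs_Suc)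
    ultimately have "card ?S \<le> q ^ length d"
      using card_inj_on_le[of tl ?S "vecs q (length d)"] finite_vecs card_vecs by metis
    then show ?thesis by simp
  qed
qed simp

text \<open>A collision means that \<open>q\<close> divides the dot product of every row with
  \<open>x - y\<close>. The \<open>k\<close> rows are chosen freely, so the bound for one row is
  raised to the power \<open>k\<close>.\<close>

lemma lin_hash_collisions:
  fixes k :: nat
  assumes q: "prime q" and len: "length x = n" "length y = n"
    and "\<exists>(u, v)\<in>set (zip x y). \<not> int q dvd u - v"
  defines "I \<equiv> {M. set M \<subseteq> vecs q n \<and> length M = k}"
  shows "q ^ k * card {M \<in> I. lin_hash q M x = lin_hash q M y} \<le> card I"
proof -
  let ?C = "{a \<in> vecs q n. int q dvd dot a (map2 (-) x y)}"
  have diff: "dot a (map2 (-) x y) = dot a x - dot a y" for a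
    using len(1)[folded len(2)]
  proof (induction x y arbitrary: a rule: list_induct2)
    case (Cons u x v y)
    then show ?case by (cases a) (simp_all add: algebra_simps)
  qed simp
  have "{M \<in> I. lin_hash q M x = lin_hash q M y} = {M. set M \<subseteq> ?C \<and> length M = k}"
    by (auto simp: I_def lin_hash_def diff mod_eq_dvd_iff)
  then have "card {M \<in> I. lin_hash q M x = lin_hash q M y} = card ?C ^ k"
    using finite_vecs by (simp add: card_lists_length_eq)
  moreover have "card I = (q ^ n) ^ k"
    unfolding I_def by (simp add: card_lists_length_eq finite_vecs card_vecs)
  moreover have "q * card ?C \<le> q ^ n"
    using card_dot_dvd[OF q, of "map2 (-) x y"] assms(4) len by force
  ultimately show ?thesis
    using power_mono[of "q * card ?C" "q ^ n" k] by (simp add: power_mult_distrib)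
qed

subsection \<open>Independent repetitions\<close>

text \<open>Masses multiply over independent coordinates, so the logarithm becomes a sum of
  independent terms whose variance can be computed.\<close>

lemma log_mass_replicate:
  assumes "fin_dist A p" "l \<in> prod_set (replicate n (A, p))"
  shows "log 2 (mass (prod_set (replicate n (A, p))) (prod_wt (replicate n (A, p))) (map f) l)
    = (\<Sum>a\<leftarrow>l. log 2 (mass A p f a))"
  using assms(2)
proof (induction n arbitrary: l)
  case 0
  then show ?case by (simp add: mass_def)
next
  case (Suc n)
  let ?D = "replicate n (A, p)"
  have D: "fin_dists ?D" using assms(1) by (simp add: fin_dists_def)
  obtain a l' where l: "l = a # l'" "a \<in> A" "l' \<in> prod_set ?D"
    using Suc.prems by auto
  show ?case
    unfolding replicate_Suc l(1) mass_prod_Cons[OF assms(1) D]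
    using mass_pos[OF assms(1) l(2), of f] mass_pos[OF fin_dist_prod[OF D] l(3), of "map f"] Suc.IH[OF l(3)]
    by (simp add: log_mult_pos)
qed

text \<open>The cross terms in the square of the sum vanish because the means do; therefore both
  claims go through one induction.\<close>

lemma variance_replicate:
  fixes n :: nat and t :: "'a \<Rightarrow> real"
  assumes "fin_dist A p" "(\<Sum>a\<in>A. p a * t a) = 0"
  defines "D \<equiv> \<lambda>n. replicate n (A, p)"
  shows "(\<Sum>l\<in>prod_set (D n). prod_wt (D n) l * sum_list (map t l)) = 0"
    and "(\<Sum>l\<in>prod_set (D n). prod_wt (D n) l * (sum_list (map t l))\<^sup>2) = n * (\<Sum>a\<in>A. p a * (t a)\<^sup>2)"
proof (induction n)
  case 0
  case 1
  then show ?case by (simp add: D_def)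
  case 2
  then show ?case by (simp add: D_def)
next
  case (Suc n)
  let ?B = "prod_set (D n)" and ?P = "prod_wt (D n)"
  let ?T = "\<lambda>l. sum_list (map t l)"
  have one: "fin_dist ?B ?P"
    using assms(1) by (intro fin_dist_prod) (simp add: D_def fin_dists_def)
  have DS: "D (Suc n) = (A, p) # D n" by (simp add: D_def)
  case 1
  show ?case
    unfolding DS sum_prod_set_Cons
    using sum_product_add[OF assms(1) one, of t ?T] Suc(1) assms(2) by simp
  case 2
  have "(\<Sum>l\<in>prod_set (D (Suc n)). prod_wt (D (Suc n)) l * (?T l)\<^sup>2)
      = (\<Sum>a\<in>A. \<Sum>l\<in>?B. p a * ?P l * ((t a)\<^sup>2 + (?T l)\<^sup>2))
        + (\<Sum>a\<in>A. \<Sum>l\<in>?B. 2 * (p a * t a) * (?P l * ?T l))"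
    unfolding DS sum_prod_set_Cons sum.distrib[symmetric]
    by (intro sum.cong refl) (simp add: power2_eq_square algebra_simps)
  also have "(\<Sum>a\<in>A. \<Sum>l\<in>?B. 2 * (p a * t a) * (?P l * ?T l)) = 0"
    using Suc(1) by (simp add: sum_distrib_left[symmetric])
  finally show ?case
    unfolding sum_product_add[OF assms(1) one] using Suc(2) by (simp add: algebra_simps)
qed

text \<open>Taking \<open>m * m\<close> copies makes the square root of their number the integer
  \<open>m\<close>. The bound of \<open>\<bar>u\<bar>\<close> by its square, balanced at size
  \<open>m\<close>, stands in for the Cauchy-Schwarz inequality.\<close>

lemma mean_deviation_replicate:
  fixes m :: nat and t :: "'a \<Rightarrow> real"
  assumes "fin_dist A p" "(\<Sum>a\<in>A. p a * t a) = 0" "0 < m"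
  defines "D \<equiv> replicate (m * m) (A, p)"
  shows "(\<Sum>l\<in>prod_set D. prod_wt D l * \<bar>sum_list (map t l)\<bar>) \<le> m * ((\<Sum>a\<in>A. p a * (t a)\<^sup>2) + 1) / 2"
proof -
  have dist: "fin_dist (prod_set D) (prod_wt D)"
    using assms(1) by (intro fin_dist_prod) (simp add: D_def fin_dists_def)
  have amgm: "\<bar>u\<bar> \<le> u\<^sup>2 / (2 * m) + m / 2" for u :: real
  proof -
    have "0 \<le> (\<bar>u\<bar> - m)\<^sup>2" by simp
    then have "2 * m * \<bar>u\<bar> \<le> u\<^sup>2 + m * m" by (simp add: power2_eq_square algebra_simps)
    then show ?thesis using assms(3) by (simp add: field_simps)
  qed
  have "(\<Sum>l\<in>prod_set D. prod_wt D l * \<bar>sum_list (map t l)\<bar>)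
      \<le> (\<Sum>l\<in>prod_set D. prod_wt D l * ((sum_list (map t l))\<^sup>2 / (2 * m) + m / 2))"
    using dist by (intro sum_mono mult_left_mono amgm) (auto simp: fin_dist_def less_imp_le)
  also have "\<dots> = (\<Sum>l\<in>prod_set D. prod_wt D l * (sum_list (map t l))\<^sup>2) / (2 * m)
      + sum (prod_wt D) (prod_set D) * (m / 2)"
    by (simp add: sum.distrib sum_divide_distrib sum_distrib_right distrib_left)
  also have "\<dots> = m * ((\<Sum>a\<in>A. p a * (t a)\<^sup>2) + 1) / 2"
    using variance_replicate(2)[OF assms(1,2), of "m * m"] dist assms(3)
    by (simp add: D_def fin_dist_def field_simps)
  finally show ?thesis .
qed

subsection \<open>The homogeneous inequality\<close>

lemma beta_admissible_ent_homogeneous: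
  fixes X Y :: "'a \<Rightarrow> int"
  assumes adm: "beta_admissible R \<beta>" "finite R" "R \<noteq> {}" "0 \<le> \<beta>" and dist: "fin_dist A p"
    and mx: "\<And>r. r \<in> R \<Longrightarrow> ent A p (lin_comb X r Y) \<le> mx"
  defines "h \<equiv> ent A p (\<lambda>a. (X a, Y a)) - ent A p Y"
  shows "ent A p Y - h \<le> \<beta> * (mx - h)"
proof -
  let ?XY = "\<lambda>a. (X a, Y a)"
  have fin: "finite A" using dist by (simp add: fin_dist_def)
  define denom where "denom r = snd (quotient_of r)" for r
  define numer where "numer r = fst (quotient_of r)" for r
  have denom: "0 < denom r" "r = of_int (numer r) / of_int (denom r)" for r
    using quotient_of_denom_pos'[of r] quotient_of_div[of r] by (auto simp: denom_def numer_def)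
  \<comment> \<open>A prime above this bound keeps distinct values of \<open>X\<close> distinct
    modulo \<open>q\<close> and makes the denominators of the slopes invertible.\<close>
  define bnd where "bnd = (\<Sum>a\<in>A. \<Sum>b\<in>A. \<bar>X a - X b\<bar>) + (\<Sum>r\<in>R. denom r)"
  obtain q :: nat where q: "prime q" "nat bnd < q" using bigger_prime by blast
  have bnd1: "\<bar>X a - X b\<bar> < q" if "a \<in> A" "b \<in> A" for a b
  proof -
    have "\<bar>X a - X b\<bar> \<le> (\<Sum>b\<in>A. \<bar>X a - X b\<bar>)"
      using fin that by (intro member_le_sum) auto
    also have "\<dots> \<le> (\<Sum>a\<in>A. \<Sum>b\<in>A. \<bar>X a - X b\<bar>)"
      using fin that by (intro member_le_sum[where f = "\<lambda>a. \<Sum>b\<in>A. \<bar>X a - X b\<bar>"]) (auto intro: sum_nonneg)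
    also have "\<dots> \<le> bnd"
      unfolding bnd_def using denom(1) by (auto intro!: sum_nonneg simp: less_imp_le)
    finally show ?thesis using q(2) by linarith
  qed
  have bnd2: "denom r < q" if "r \<in> R" for r
  proof -
    have "denom r \<le> (\<Sum>r\<in>R. denom r)"
      using denom(1) that adm(2) by (intro member_le_sum) (auto simp: less_imp_le)
    also have "\<dots> \<le> bnd" unfolding bnd_def by (auto intro!: sum_nonneg)
    finally show ?thesis using q(2) by linarith
  qed
  have coprime_denom: "coprime (int q) (denom r)" if "r \<in> R" for r
    using q(1) denom(1)[of r] bnd2[OF that]
    by (intro prime_imp_coprime) (auto dest: zdvd_imp_le)
  have q1: "1 < real q" using prime_gt_1_nat[OF q(1)] by simp
  \<comment> \<open>The information density of X given Y: its mean is \<open>h\<close>, so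
    \<open>t\<close> is centred and its sum over independent copies deviates only by the order of
    the square root of their number.\<close>
  define s where "s a = log 2 (mass A p Y a) - log 2 (mass A p ?XY a)" for a
  define t where "t a = s a - h" for a
  define V where "V = (\<Sum>a\<in>A. p a * (t a)\<^sup>2)"
  define lq where "lq = log 2 q"
  have lq: "0 < lq" unfolding lq_def using q1 by simp
  have h0: "0 \<le> h"
    using ent_mono[OF dist, of ?XY Y] by (auto simp: h_def)
  have s_sum: "(\<Sum>a\<in>A. p a * s a) = h"
    by (simp add: s_def h_def ent_def right_diff_distrib sum_subtractf)
  have t0: "(\<Sum>a\<in>A. p a * t a) = 0"
    using dist s_sum by (simp add: t_def right_diff_distrib sum_subtractf fin_dist_def
        flip: sum_distrib_right)
  define gap where "gap = ent A p Y - h - \<beta> * (mx - h)"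
  \<comment> \<open>With \<open>m * m\<close> copies the gap is multiplied by \<open>m * m\<close>,
    but all errors are linear in \<open>m\<close>. After division by \<open>m\<close> the bound no
    longer depends on \<open>m\<close>, which forces \<open>gap \<le> 0\<close>.\<close>
  have "real m * gap \<le> (1 + \<beta>) * (1 + lq + (V + 1) / 2)" if m: "0 < m" for m :: nat
  proof -
    define n where "n = m * m"
    define D where "D = replicate n (A, p)"
    let ?B = "prod_set D" and ?P = "prod_wt D"
    \<comment> \<open>The largest number of rows for which the range size \<open>q ^ k\<close> stays
      below 2 to the power \<open>n * h\<close>; the rounding costs at most \<open>lq\<close>
      bits.\<close>
    define k where "k = nat \<lfloor>n * h / lq\<rfloor>"
    define L where "L = k * lq"
    define e where "e = 1 + lq + m * (V + 1) / 2"
    have L: "L \<le> n * h" "n * h - L \<le> lq"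
    proof -
      have "0 \<le> n * h / lq" using h0 lq by simp
      then have "real k \<le> n * h / lq" "n * h / lq \<le> real k + 1"
        unfolding k_def by linarith+
      then show "L \<le> n * h" "n * h - L \<le> lq"
        using lq by (simp_all add: L_def field_simps)
    qed
    have qk: "0 < real q ^ k" "log 2 (real q ^ k) = L"
      using q1 by (simp_all add: L_def lq_def log_nat_power)
    have D: "fin_dists D" using dist by (simp add: D_def fin_dists_def)
    note distB = fin_dist_prod[OF D]
    have lenB: "length l = n" if "l \<in> ?B" for l
      using length_prod_set[OF that] by (simp add: D_def)
    have setB: "set l \<subseteq> A" if "l \<in> ?B" for l
      using that unfolding D_def by (induction n arbitrary: l) (simp, fastforce)
    have entB: "ent ?B ?P (map f) = n * ent A p f" for f :: "'a \<Rightarrow> 'z"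
      unfolding ent_prod[OF D] by (simp add: D_def sum_list_replicate)
    have entXY: "ent ?B ?P (\<lambda>l. (map X l, map Y l)) = n * ent A p ?XY"
      unfolding entB[symmetric] by (rule ent_cong) (auto simp: list_eq_iff_nth_eq)
    have S: "log 2 (mass ?B ?P (map Y) l / mass ?B ?P (\<lambda>l. (map X l, map Y l)) l) - n * h
        = sum_list (map t l)" if l: "l \<in> ?B" for l
    proof -
      have "mass ?B ?P (\<lambda>l. (map X l, map Y l)) l = mass ?B ?P (map ?XY) l"
        by (rule mass_cong) (auto simp: list_eq_iff_nth_eq)
      then have "log 2 (mass ?B ?P (map Y) l / mass ?B ?P (\<lambda>l. (map X l, map Y l)) l)
          = log 2 (mass ?B ?P (map Y) l) - log 2 (mass ?B ?P (map ?XY) l)"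
        using mass_pos[OF distB l, of "map Y"] mass_pos[OF distB l, of "map ?XY"]
        by (simp add: log_divide_pos)
      also have "\<dots> = (\<Sum>a\<leftarrow>l. s a)"
        using l log_mass_replicate[OF dist, of l n Y] log_mass_replicate[OF dist, of l n ?XY]
        unfolding D_def
        by (simp add: s_def sum_list_subtractf)
      also have "\<dots> - n * h = sum_list (map t l)"
        unfolding lenB[OF l, symmetric] by (induction l) (simp_all add: t_def algebra_simps)
      finally show ?thesis by simp
    qed
    define I where "I = {M. set M \<subseteq> vecs q n \<and> length M = k}"
    have I: "finite I" "I \<noteq> {}"
    proof -
      show "finite I" unfolding I_def by (rule finite_lists_length_eq) (rule finite_vecs)
      have "replicate n 0 \<in> vecs q n" using q1 by (auto simp: vecs_def)
      then have "replicate k (replicate n 0) \<in> I" by (auto simp: I_def)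
      then show "I \<noteq> {}" by blast
    qed
    have coll: "real q ^ k * card {M \<in> I. lin_hash q M (map X l) = lin_hash q M (map X l')} \<le> real (card I)"
      if l: "l \<in> ?B" "l' \<in> ?B" "map X l \<noteq> map X l'" for l l'
    proof -
      obtain i where i: "i < n" "X (l ! i) \<noteq> X (l' ! i)"
        using l lenB by (auto simp: list_eq_iff_nth_eq)
      have "l ! i \<in> A" "l' ! i \<in> A"
        using i(1) l setB lenB nth_mem by (metis subsetD)+
      then have "\<not> int q dvd X (l ! i) - X (l' ! i)"
        using bnd1[of "l ! i" "l' ! i"] i(2) dvd_imp_le_int[of "X (l ! i) - X (l' ! i)" "int q"]
        by auto
      moreover have "(X (l ! i), X (l' ! i)) \<in> set (zip (map X l) (map X l'))"
        using i(1) l lenB by (auto simp: set_zip intro!: exI[of _ i])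
      ultimately have "q ^ k * card {M \<in> I. lin_hash q M (map X l) = lin_hash q M (map X l')} \<le> card I"
        unfolding I_def using l lenB by (intro lin_hash_collisions[OF q(1)]) auto
      then show ?thesis by (simp flip: of_nat_power of_nat_mult)
    qed
    obtain M where M: "M \<in> I"
      "ent ?B ?P (\<lambda>l. (map X l, map Y l)) - ent ?B ?P (\<lambda>l. (lin_hash q M (map X l), map Y l))
        \<le> 1 + (\<Sum>l\<in>?B. ?P l * \<bar>log 2 (mass ?B ?P (map Y) l
            / mass ?B ?P (\<lambda>l. (map X l, map Y l)) l) - log 2 (real q ^ k)\<bar>)"
      by (rule exists_good_hash[where f = "map X" and g = "map Y" and hash = "lin_hash q",
            OF distB I qk(1) coll])
    note M(2)
    also have "(\<Sum>l\<in>?B. ?P l * \<bar>log 2 (mass ?B ?P (map Y) l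
            / mass ?B ?P (\<lambda>l. (map X l, map Y l)) l) - log 2 (real q ^ k)\<bar>)
        \<le> (\<Sum>l\<in>?B. ?P l * (\<bar>sum_list (map t l)\<bar> + lq))"
      using distB S L unfolding qk(2)
      by (intro sum_mono mult_left_mono) (fastforce simp: fin_dist_def less_imp_le)+
    also have "\<dots> = (\<Sum>l\<in>?B. ?P l * \<bar>sum_list (map t l)\<bar>) + lq"
      using distB by (simp add: distrib_left sum.distrib fin_dist_def flip: sum_distrib_right)
    also have "(\<Sum>l\<in>?B. ?P l * \<bar>sum_list (map t l)\<bar>) \<le> m * (V + 1) / 2"
      using mean_deviation_replicate[OF dist t0 m] by (simp add: D_def n_def V_def)
    finally have loss: "ent ?B ?P (\<lambda>l. (map X l, map Y l))
        - ent ?B ?P (\<lambda>l. (lin_hash q M (map X l), map Y l)) \<le> e"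
      by (simp add: e_def)
    define W where "W l = (lin_hash q M (map X l), lin_hash q M (map Y l))" for l
    \<comment> \<open>This is H(\<phi> X | Y) for the hash \<phi> given by \<open>M\<close>; before
      hashing the value is \<open>n * h\<close>, and by \<open>loss\<close> at most \<open>e\<close>
      is lost.\<close>
    define g where "g = ent ?B ?P (\<lambda>l. (lin_hash q M (map X l), map Y l)) - ent ?B ?P (map Y)"
    have g: "n * h - e \<le> g"
      using loss unfolding entXY g_def entB h_def by (simp add: algebra_simps)
    have entW: "ent ?B ?P W \<le> 2 * L"
    proof -
      have "lin_hash q M x \<in> vecs q k" for x
        using M(1) q1 by (auto simp: I_def lin_hash_def vecs_def)
      then have "W ` ?B \<subseteq> vecs q k \<times> vecs q k" by (auto simp: W_def)
      then have "ent ?B ?P W \<le> log 2 (card (vecs q k \<times> vecs q k))"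
        by (intro ent_le_log_card distB) (auto simp: finite_vecs)
      also have "\<dots> = 2 * L"
        using qk q1 by (simp add: card_cartesian_product card_vecs log_mult_pos)
      finally show ?thesis .
    qed
    obtain X' Y' :: "'a list \<Rightarrow> int" where enc: "\<forall>l\<in>?B. \<forall>l'\<in>?B.
        (Y' l' = Y' l \<longleftrightarrow> map Y l' = map Y l) \<and> (\<forall>r\<in>R. lin_comb X' r Y' l' = lin_comb X' r Y' l
          \<longleftrightarrow> map (lin_comb X r Y) l' = map (lin_comb X r Y) l)"
      using exists_integer_encoding[OF adm(2) D, of Y X] by (elim exE) (rule that)
    have upper: "ent ?B ?P (\<lambda>l. (lin_comb X' r Y' l, W l)) - ent ?B ?P W \<le> n * mx - g"
      if r: "r \<in> R" for r
    proof -
      \<comment> \<open>\<open>X + r Y\<close> scaled to be integral, so that it can be hashed; since \<open>q\<close> does not divide the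
        denominator, the hash of \<open>U\<close> still determines that of \<open>X\<close> once \<open>Y\<close> is known.\<close>
      define U where "U l = map (\<lambda>a. denom r * X a + numer r * Y a) l" for l
      have U: "U l = map (\<lambda>z. \<lfloor>of_int (denom r) * z\<rfloor>) (map (lin_comb X r Y) l)" for l
      proof -
        have "of_int (denom r) * lin_comb X r Y a = of_int (denom r * X a + numer r * Y a)" for a
        proof -
          have "rat_of_int (denom r) * r = of_int (numer r)"
            using denom[of r] by (metis less_irrefl nonzero_mult_div_cancel_left of_int_0_eq_iff
                times_divide_eq_right)
          moreover have "of_int (denom r) * lin_comb X r Y a
              = of_int (denom r) * of_int (X a) + (of_int (denom r) * r) * of_int (Y a)"
            by (simp only: lin_comb_def distrib_left mult.assoc)
          ultimately show ?thesis by simp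
        qed
        then show ?thesis by (simp only: U_def map_map comp_def floor_of_int)
      qed
      have dotU: "dot a (U l) = denom r * dot a (map X l) + numer r * dot a (map Y l)" for a l
        unfolding U_def by (rule dot_linear)
      have hash_eq: "lin_hash q M x = lin_hash q M y
          \<longleftrightarrow> (\<forall>a\<in>set M. int q dvd dot a x - dot a y)" for x y
        by (auto simp: lin_hash_def mod_eq_dvd_iff)
      \<comment> \<open>The hash of \<open>U\<close> is an integer combination of the two hashes in
        \<open>W\<close>.\<close>
      have WU: "lin_hash q M (U l) = lin_hash q M (U l')" if "W l = W l'" for l l'
      proof -
        have "int q dvd denom r * (dot a (map X l) - dot a (map X l'))
            + numer r * (dot a (map Y l) - dot a (map Y l'))" if "a \<in> set M" for a
          using \<open>W l = W l'\<close> that by (simp add: W_def hash_eq)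
        then show ?thesis by (simp add: hash_eq dotU algebra_simps)
      qed
      have UX: "lin_hash q M (map X l) = lin_hash q M (map X l')"
        if "lin_hash q M (U l) = lin_hash q M (U l')" "map Y l = map Y l'" for l l'
      proof -
        have "int q dvd denom r * (dot a (map X l) - dot a (map X l'))" if "a \<in> set M" for a
          using \<open>lin_hash q M (U l) = lin_hash q M (U l')\<close> \<open>map Y l = map Y l'\<close> that
          by (simp add: hash_eq dotU algebra_simps)
        then show ?thesis
          using coprime_denom[OF r] by (simp add: hash_eq coprime_dvd_mult_right_iff)
      qed
      have "ent ?B ?P (\<lambda>l. (lin_comb X' r Y' l, W l)) = ent ?B ?P (\<lambda>l. (map (lin_comb X r Y) l, W l))"
        using enc r by (intro ent_cong) blast
      \<comment> \<open>Submodularity with the hash of \<open>U\<close> as common function: X + rY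
        determines it through \<open>U\<close>, and \<open>W\<close> determines it by
        \<open>WU\<close>.\<close>
      moreover have "ent ?B ?P (\<lambda>l. (map (lin_comb X r Y) l, W l)) + ent ?B ?P (\<lambda>l. lin_hash q M (U l))
          \<le> ent ?B ?P (map (lin_comb X r Y)) + ent ?B ?P W"
        by (rule ent_submodular[OF distB]) (simp only: U, rule WU)
      moreover have "ent ?B ?P (map (lin_comb X r Y)) \<le> n * mx"
        unfolding entB by (intro mult_left_mono mx r) simp
      moreover have "g \<le> ent ?B ?P (\<lambda>l. lin_hash q M (U l))"
      proof -
        have "ent ?B ?P (\<lambda>l. (lin_hash q M (map X l), map Y l))
            \<le> ent ?B ?P (\<lambda>l. (lin_hash q M (U l), map Y l))"
          by (intro ent_mono distB) (auto dest: UX)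
        also have "\<dots> \<le> ent ?B ?P (\<lambda>l. lin_hash q M (U l)) + ent ?B ?P (map Y)"
          by (rule ent_Pair_le[OF distB])
        finally show ?thesis by (simp add: g_def)
      qed
      ultimately show ?thesis by simp
    qed
    \<comment> \<open>\<open>Y'\<close> determines the vector of Y and \<open>W\<close> contains the
      hash of X. Subtracting the at most \<open>2 * L\<close> bits of \<open>W\<close> gives the
      lower bound for H(Y | W).\<close>
    have "ent ?B ?P (\<lambda>l. (lin_hash q M (map X l), map Y l)) \<le> ent ?B ?P (\<lambda>l. (Y' l, W l))"
      using enc by (intro ent_mono distB) (auto simp: W_def)
    then have "ent ?B ?P (map Y) + g - 2 * L \<le> ent ?B ?P (\<lambda>l. (Y' l, W l)) - ent ?B ?P W"
      using entW by (simp add: g_def)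
    also have "\<dots> \<le> \<beta> * (n * mx - g)"
      by (rule beta_admissible_cond[OF adm distB upper])
    also have "\<dots> \<le> \<beta> * (n * mx - n * h + e)"
      using g by (intro mult_left_mono adm(4)) simp
    finally have "n * ent A p Y + g - 2 * L \<le> \<beta> * (n * mx - n * h + e)"
      unfolding entB .
    \<comment> \<open>One \<open>e\<close> comes from replacing \<open>g\<close> by
      \<open>n * h\<close> on the left, \<beta> times \<open>e\<close> from the right;
      \<open>2 * L\<close> is at most \<open>2 * n * h\<close>.\<close>
    then have "n * gap \<le> (1 + \<beta>) * e"
      using g L(1) by (simp add: gap_def algebra_simps)
    also have "\<dots> \<le> (1 + \<beta>) * (m * (1 + lq + (V + 1) / 2))"
    proof (intro mult_left_mono)
      have "1 * (1 + lq) \<le> real m * (1 + lq)"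
        using m lq by (intro mult_right_mono) auto
      then show "e \<le> m * (1 + lq + (V + 1) / 2)"
        by (simp add: e_def algebra_simps add_divide_distrib)
    qed (use adm(4) in simp)
    finally have "real m * (m * gap) \<le> real m * ((1 + \<beta>) * (1 + lq + (V + 1) / 2))"
      by (simp add: n_def mult_ac)
    then show ?thesis using m by simp
  qed
  moreover have "0 \<le> (1 + \<beta>) * (1 + lq + (V + 1) / 2)"
    using adm(4) lq dist unfolding V_def
    by (intro mult_nonneg_nonneg add_nonneg_nonneg divide_nonneg_nonneg sum_nonneg)
      (auto simp: fin_dist_def less_imp_le)
  ultimately have "real m * gap \<le> (1 + \<beta>) * (1 + lq + (V + 1) / 2)" for m :: nat
    by (cases "m = 0") auto
  then have "gap \<le> 0" by (rule nonpos_if_multiples_bounded)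
  then show ?thesis by (simp add: gap_def)
qed

text \<open>Every X + rY is a function of the bit Y here, hence has at most one bit of entropy. This
  pair forces both constants to be at least 1.\<close>

lemma exists_fair_bit:
  assumes "finite R" "R \<noteq> {}"
  obtains M :: "nat measure" and X Y where
    "rv_pair M X Y" "shannon_entropy M Y = 1" "cond_entropy M X Y = 0" "max_entropy R M X Y \<le> 1"
proof
  define p where "p = (\<lambda>_ :: nat. 1 / 2 :: real)"
  define M where "M = point_measure {0, 1 :: nat} p"
  have dist: "fin_dist {0, 1} p" by (simp add: fin_dist_def p_def)
  note P = shannon_entropy_point_measure[OF dist, folded M_def]
  have sf: "simple_function M f" for f :: "nat \<Rightarrow> 'z"
    by (simp add: M_def)
  show "rv_pair M (\<lambda>_. 0) int"
    by (simp add: rv_pair_def P(1) sf)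
  have "ent {0, 1} p int = 1"
  proof -
    have "{b. (b = 0 \<or> b = Suc 0) \<and> b = 0} = {0::nat}"
      "{b. (b = 0 \<or> b = Suc 0) \<and> b = Suc 0} = {Suc 0}" by auto
    then show ?thesis by (simp add: ent_def mass_def p_def log_divide)
  qed
  then show one: "shannon_entropy M int = 1" by (simp add: P(2))
  have "shannon_entropy M (\<lambda>_. 0 :: int) = 0"
  proof -
    have "{b. b = 0 \<or> b = Suc 0} = {0, Suc 0}" by auto
    then show ?thesis by (simp add: P(2) ent_def mass_def p_def)
  qed
  then show "cond_entropy M (\<lambda>_. 0 :: int) int = 0"
    using cond_entropy_le[OF P(1) sf sf, of "\<lambda>_. 0 :: int" int]
      cond_entropy_nonneg[OF P(1) sf sf, of "\<lambda>_. 0 :: int" int] by simp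
  show "max_entropy R M (\<lambda>_. 0) int \<le> 1"
    unfolding max_entropy_def
    using assms shannon_entropy_data_processing[OF P(1) sf[of int], of "\<lambda>y. r * of_int y" for r]
    by (auto simp: lin_comb_def one)
qed

lemma beta_h_admissible_if_beta_admissible:
  assumes adm: "beta_admissible R \<beta>" "finite R" "R \<noteq> {}" "0 \<le> \<beta>"
  shows "beta_h_admissible R \<beta>"
  unfolding beta_h_admissible_def
proof (intro allI impI)
  fix M :: "nat measure" and X Y
  assume "rv_pair M X Y"
  then have M: "prob_space M" and X: "simple_function M X" and Y: "simple_function M Y"
    by (auto simp: rv_pair_def)
  \<comment> \<open>On the joint law of the pair, X and Y become the projections \<open>fst\<close>
    and \<open>snd\<close>.\<close>
  define Z where "Z \<omega> = (X \<omega>, Y \<omega>)" for \<omega>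
  have "simple_function M Z" unfolding Z_def by (intro simple_function_Pair X Y)
  note eq = shannon_entropy_eq_ent[OF M this]
  define p where "p z = measure M (Z -` {z} \<inter> space M)" for z
  let ?A = "{z \<in> Z ` space M. 0 < p z}"
  have dist: "fin_dist ?A p" using eq(1) by (simp add: p_def[abs_def])
  have H: "shannon_entropy M (\<lambda>\<omega>. f (X \<omega>) (Y \<omega>)) = ent ?A p (\<lambda>z. f (fst z) (snd z))"
    for f :: "int \<Rightarrow> int \<Rightarrow> 'z"
    using eq(2)[of "\<lambda>z. f (fst z) (snd z)"] by (simp add: p_def[abs_def] Z_def)
  have HY: "shannon_entropy M Y = ent ?A p snd" using H[of "\<lambda>x y. y"] by simp
  have "cond_entropy M X Y = shannon_entropy M (\<lambda>\<omega>. (Y \<omega>, X \<omega>)) - shannon_entropy M Y"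
    using shannon_entropy_chain_rule[OF M Y X] by simp
  also have "shannon_entropy M (\<lambda>\<omega>. (Y \<omega>, X \<omega>)) = ent ?A p (\<lambda>z. (fst z, snd z))"
    unfolding H[of "\<lambda>x y. (y, x)"] by (rule ent_cong) (auto simp: prod_eq_iff)
  finally have h: "cond_entropy M X Y = ent ?A p (\<lambda>z. (fst z, snd z)) - ent ?A p snd"
    by (simp add: HY)
  have "ent ?A p (lin_comb fst r snd) \<le> max_entropy R M X Y" if "r \<in> R" for r
    using shannon_entropy_le_max_entropy[OF adm(2) that, of M X Y]
      H[of "\<lambda>x y. of_int x + r * of_int y"] by (simp add: lin_comb_def)
  from beta_admissible_ent_homogeneous[OF adm dist this]
  have "shannon_entropy M Y - cond_entropy M X Y \<le> \<beta> * (max_entropy R M X Y - cond_entropy M X Y)"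
    by (simp only: HY h)
  then show "shannon_entropy M Y + (\<beta> - 1) * cond_entropy M X Y \<le> \<beta> * max_entropy R M X Y"
    by (simp add: algebra_simps)
qed

lemma beta_admissible_if_beta_h_admissible:
  assumes "beta_h_admissible R \<beta>" "1 \<le> \<beta>"
  shows "beta_admissible R \<beta>"
  unfolding beta_admissible_def
proof (intro allI impI)
  fix M :: "nat measure" and X Y
  assume rv: "rv_pair M X Y"
  then have "0 \<le> (\<beta> - 1) * cond_entropy M X Y"
    using assms(2) by (intro mult_nonneg_nonneg cond_entropy_nonneg) (auto simp: rv_pair_def)
  then show "shannon_entropy M Y \<le> \<beta> * max_entropy R M X Y"
    using beta_h_admissible_D[OF assms(1) rv] by simp
qed

theorem theorem1p1:
  fixes R :: "rat set"
  assumes "finite R" and "card R \<ge> 2"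
  shows "beta_h R = beta R"
proof (rule antisym)
  have R: "R \<noteq> {}" using assms(2) by auto
  obtain M :: "nat measure" and X Y where M: "rv_pair M X Y" "shannon_entropy M Y = 1"
    "cond_entropy M X Y = 0" "max_entropy R M X Y \<le> 1"
    by (rule exists_fair_bit[OF assms(1) R])
  have ge_1: "1 \<le> b" if "1 \<le> b * max_entropy R M X Y" for b
  proof (rule ccontr)
    assume "\<not> 1 \<le> b"
    have "0 \<le> max_entropy R M X Y"
      using cond_entropy_le_max_entropy[OF assms(1) _ M(1)] M(3) R by force
    then have "b * max_entropy R M X Y \<le> 1 * max_entropy R M X Y"
      using \<open>\<not> 1 \<le> b\<close> by (intro mult_right_mono) auto
    then have "max_entropy R M X Y = 1" using that M(4) by simp
    then show False using that \<open>\<not> 1 \<le> b\<close> by simp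
  qed
  have "1 \<le> beta R"
    using beta_admissible_D[OF beta_least(1)[OF assms] M(1)] M(2) by (simp add: ge_1)
  then have "beta_h_admissible R (beta R)"
    using beta_h_admissible_if_beta_admissible[OF beta_least(1)[OF assms] assms(1) R] by simp
  then show "beta_h R \<le> beta R" by (rule beta_h_least(2)[OF assms])
  have "1 \<le> beta_h R"
    using beta_h_admissible_D[OF beta_h_least(1)[OF assms] M(1)] M(2,3) by (simp add: ge_1)
  then have "beta_admissible R (beta_h R)"
    by (rule beta_admissible_if_beta_h_admissible[OF beta_h_least(1)[OF assms]])
  then show "beta R \<le> beta_h R" by (rule beta_least(2)[OF assms])
qed

end
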